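(* Let $\mathcal P$ be a chiral polytope of type $\{p_1, \ldots, p_{n-1}\}$, and suppose that \[ \left( \frac{|\Gamma^+(\mathcal P) \diamond \Gamma^+(\overline{\mathcal P})|}{|\Gamma^+(\mathcal P)|} \right)^2 > \left|[p_1, \ldots, p_{n-1}]^+ \mathbin{\square} [p_{n-1}, \ldots, p_1]^+\right|. \] Then $\mathcal P \diamond \mathcal P^{\delta}$ is chiral.
   Context: An abstract polytope of rank $n$ (an $n$-polytope) is a ranked poset of faces with ranks from $-1$ to $n$, with a unique least face (rank $-1$) and a unique greatest face (rank $n$), in which every flag (maximal chain) has $n+2$ faces, which satisfies the diamond condition (whenever $F<G$ with ranks $j-1$ and $j+1$ there are exactly two $j$-faces strictly between them), and which is strongly flag-connected (any two flags $\Phi,\Psi$ are joined by a sequence of flags, consecutive ones adjacent, all containing $\Phi\cap\Psi$; two flags are adjacent if they differ in exactly one face). $\Phi^j$ denotes the unique flag differing from $\Phi$ only in its $j$-face, and $\Phi^{i,j}=(\Phi^i)^j$. Each polytope considered has a fixed base flag $\Phi$. $\mathcal P$ is chiral if its automorphism group $\Gamma(\mathcal P)$ has exactly two orbits on flags and adjacent flags lie in distinct orbits; then $\Gamma^+(\mathcal P):=\Gamma(\mathcal P)$ is generated by $\sigma_1,\dots,\sigma_{n-1}$, where $\sigma_i$ maps $\Phi$ to $\Phi^{i,i-1}$. One has $(\sigma_i\cdots\sigma_j)^2=1$ for $i<j$, and the type of $\mathcal P$ is $\{p_1,\dots,p_{n-1}\}$ where $p_i$ is the order of $\sigma_i$.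 $[p_1,\dots,p_{n-1}]^+$ denotes the rotation subgroup of the string Coxeter group $[p_1,\dots,p_{n-1}]$, i.e. the group $\langle\sigma_1,\dots,\sigma_{n-1}\mid \sigma_i^{p_i}=1\ (1\le i\le n-1),\ (\sigma_i\cdots\sigma_j)^2=1\ (1\le i<j\le n-1)\rangle$ with these specified generators (the relation $\sigma_i^{p_i}=1$ being omitted if $p_i=\infty$). Let $W^+=\langle \sigma_1,\dots,\sigma_{n-1}\mid (\sigma_i\cdots\sigma_j)^2=1 \text{ for } 1\le i<j\le n-1\rangle$. Writing $\Gamma^+(\mathcal P)=W^+/M$ means that $M$ is the kernel of the epimorphism $W^+\to\Gamma^+(\mathcal P)$ preserving the specified generators. For $w\in W^+$, $\overline w$ is obtained by replacing $\sigma_1$ by $\sigma_1^{-1}$, $\sigma_2$ by $\sigma_1^2\sigma_2$ and fixing $\sigma_j$ for $j\ge3$; $\delta(w)$ is obtained by replacing each $\sigma_i$ by $\sigma_{n-i}^{-1}$ (both are automorphisms of $W^+$). Put $\overline M=\{\overline w:w\in M\}$, $\delta(M)=\{\delta(w):w\in M\}$; one has $\delta(\overline M)=\overline{\delta(M)}$. If $\Gamma^+(\mathcal P)=W^+/M$ with $\mathcal P$ chiral, then $\overline M\ne M$; the mirror image $\overline{\mathcal P}$ (same faces, base flag $\Phi^0$) has $\Gamma^+(\overline{\mathcal P})=W^+/\overline M$, and the dual $\mathcal P^\delta$ (reversed order) has $\Gamma^+(\mathcal P^\delta)=W^+/\delta(M)$. Mix and comix: for groups with specified generators $\Gamma=\langle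 x_1,\dots,x_k\mid R\rangle$, $\Gamma'=\langle x_1',\dots,x_k'\mid S\rangle$, the mix $\Gamma\diamond\Gamma'$ is the subgroup of $\Gamma\times\Gamma'$ with specified generators $(x_i,x_i')$, $i=1,\dots,k$, and the comix $\Gamma\mathbin{\square}\Gamma'$ is the group $\langle x_1,x_1',\dots,x_k,x_k'\mid R,S,x_1^{-1}x_1',\dots,x_k^{-1}x_k'\rangle$. $\mathcal P\diamond\mathcal Q$ is the flag-connected pre-polytope (polytope axioms with strong flag-connectedness weakened to flag-connectedness) built from $\Gamma^+(\mathcal P)\diamond\Gamma^+(\mathcal Q)$; it is handled through $\Gamma^+(\mathcal P\diamond\mathcal Q)=\Gamma^+(\mathcal P)\diamond\Gamma^+(\mathcal Q)=W^+/N$, and it is directly regular if $\overline N=N$ and chiral if $\overline N\ne N$ (it need not be polytopal). *)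

theory Defs
  imports "HOL-Algebra.Algebra" "HOL-Library.Extended_Nonnegative_Real"
begin

section \<open>Abstract polytopes with a base flag\<close>

text \<open>The faces are the field of the (reflexive) order relation \<open>le\<close>.\<close>

record 'a based_poset =
  le :: "'a rel"
  rk :: "'a \<Rightarrow> int"
  base :: "'a set"

definition faces :: "'a based_poset \<Rightarrow> 'a set" where
  "faces P = Field (le P)"

definition lt :: "'a based_poset \<Rightarrow> 'a \<Rightarrow> 'a \<Rightarrow> bool" where
  "lt P F G \<longleftrightarrow> (F, G) \<in> le P \<and> F \<noteq> G"

definition flags :: "'a based_poset \<Rightarrow> 'a set set" where
  "flags P = {C \<in> Chains (le P). \<forall>D \<in> Chains (le P). C \<subseteq> D \<longrightarrow> D = C}"

definition adjacent :: "'a based_poset \<Rightarrow> 'a set \<Rightarrow> 'a set \<Rightarrow> bool" where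
  "adjacent P A B \<longleftrightarrow> A \<in> flags P \<and> B \<in> flags P \<and> card (A - B) = 1 \<and> card (B - A) = 1"

definition ranked_poset :: "nat \<Rightarrow> 'a based_poset \<Rightarrow> bool" where
  "ranked_poset n P \<longleftrightarrow>
     Partial_order (le P) \<and>
     (\<forall>F \<in> faces P. -1 \<le> rk P F \<and> rk P F \<le> int n) \<and>
     (\<forall>F G. lt P F G \<longrightarrow> rk P F < rk P G)"

definition diamond_condition :: "'a based_poset \<Rightarrow> bool" where
  "diamond_condition P \<longleftrightarrow>
     (\<forall>F G. lt P F G \<and> rk P G = rk P F + 2 \<longrightarrow>
        card {H. lt P F H \<and> lt P H G \<and> rk P H = rk P F + 1} = 2)"

definition strongly_flag_connected :: "'a based_poset \<Rightarrow> bool" where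
  "strongly_flag_connected P \<longleftrightarrow>
     (\<forall>A \<in> flags P. \<forall>B \<in> flags P.
        (A, B) \<in> {(C, D). adjacent P C D \<and> A \<inter> B \<subseteq> C \<and> A \<inter> B \<subseteq> D}\<^sup>*)"

definition abstract_polytope :: "nat \<Rightarrow> 'a based_poset \<Rightarrow> bool" where
  "abstract_polytope n P \<longleftrightarrow>
     ranked_poset n P \<and>
     (\<exists>F \<in> faces P. rk P F = -1 \<and> (\<forall>G \<in> faces P. (F, G) \<in> le P)) \<and>
     (\<exists>F \<in> faces P. rk P F = int n \<and> (\<forall>G \<in> faces P. (G, F) \<in> le P)) \<and>
     (\<forall>C \<in> flags P. card C = n + 2) \<and>
     diamond_condition P \<and>
     strongly_flag_connected P \<and>
     base P \<in> flags P"

text \<open>The flag \<open>\<Phi>\<^sup>j\<close>; in an \<open>n\<close>-polytope it is well defined for \<open>0 \<le> j \<le> n - 1\<close>.\<close>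

definition adj_flag :: "'a based_poset \<Rightarrow> 'a set \<Rightarrow> int \<Rightarrow> 'a set" where
  "adj_flag P A j =
     (THE B. B \<in> flags P \<and> B \<noteq> A \<and> {F \<in> B. rk P F \<noteq> j} = {F \<in> A. rk P F \<noteq> j})"

text \<open>Automorphisms act on the right: the product \<open>f \<otimes> g\<close> applies \<open>f\<close> first.  With the generators
  \<open>\<sigma>\<^sub>i : \<Phi> \<mapsto> \<Phi>\<^bsup>i,i-1\<^esup>\<close> this is the convention under which \<open>\<sigma>\<^sub>i \<cdots> \<sigma>\<^sub>j\<close> is an involution for \<open>i < j\<close>.\<close>

definition aut_group :: "'a based_poset \<Rightarrow> ('a \<Rightarrow> 'a) monoid" where
  "aut_group P =
     \<lparr>carrier = {f \<in> Bij (faces P).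
         \<forall>F \<in> faces P. \<forall>G \<in> faces P. (f F, f G) \<in> le P \<longleftrightarrow> (F, G) \<in> le P},
      monoid.mult = (\<lambda>f g. compose (faces P) g f),
      one = (\<lambda>F \<in> faces P. F)\<rparr>"

definition chiral_polytope :: "nat \<Rightarrow> 'a based_poset \<Rightarrow> bool" where
  "chiral_polytope n P \<longleftrightarrow>
     abstract_polytope n P \<and>
     card (orbits (aut_group P) (flags P) (\<lambda>f C. f ` C)) = 2 \<and>
     (\<forall>A B. adjacent P A B \<longrightarrow>
        orbit (aut_group P) (\<lambda>f C. f ` C) A \<noteq> orbit (aut_group P) (\<lambda>f C. f ` C) B)"

text \<open>For chiral \<open>P\<close> the group \<open>\<Gamma>\<^sup>+(P) = \<Gamma>(P)\<close> is \<open>aut_group P\<close> with specified generators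
  \<open>rot_gen P i\<close>, \<open>1 \<le> i \<le> n - 1\<close>.\<close>

definition rot_gen :: "'a based_poset \<Rightarrow> nat \<Rightarrow> 'a \<Rightarrow> 'a" where
  "rot_gen P i =
     (THE f. f \<in> carrier (aut_group P) \<and>
        f ` base P = adj_flag P (adj_flag P (base P) (int i)) (int i - 1))"

text \<open>An infinite entry of the type is encoded as \<open>0\<close>, which is the value of \<open>group.ord\<close> at an
  element of infinite order.\<close>

definition has_type :: "nat \<Rightarrow> 'a based_poset \<Rightarrow> (nat \<Rightarrow> nat) \<Rightarrow> bool" where
  "has_type n P p \<longleftrightarrow> (\<forall>i \<in> {1..n - 1}. p i = group.ord (aut_group P) (rot_gen P i))"

definition mirror :: "'a based_poset \<Rightarrow> 'a based_poset" where
  "mirror P = P\<lparr>base := adj_flag P (base P) 0\<rparr>"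

definition dual_poset :: "nat \<Rightarrow> 'a based_poset \<Rightarrow> 'a based_poset" where
  "dual_poset n P =
     \<lparr>le = (le P)\<inverse>, rk = (\<lambda>F. int n - 1 - rk P F), base = base P\<rparr>"


section \<open>Group presentations\<close>

text \<open>The letter \<open>(x, True)\<close> stands for \<open>x\<close> and \<open>(x, False)\<close> for its inverse.\<close>

type_synonym 'g word = "('g \<times> bool) list"

inductive_set pres_rel :: "'g set \<Rightarrow> 'g word set \<Rightarrow> 'g word rel"
  for Xs :: "'g set" and R :: "'g word set" where
  refl: "w \<in> lists (Xs \<times> UNIV) \<Longrightarrow> (w, w) \<in> pres_rel Xs R"
| sym: "(u, v) \<in> pres_rel Xs R \<Longrightarrow> (v, u) \<in> pres_rel Xs R"
| trans: "(u, v) \<in> pres_rel Xs R \<Longrightarrow> (v, w) \<in> pres_rel Xs R \<Longrightarrow> (u, w) \<in> pres_rel Xs R"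
| cancel: "u \<in> lists (Xs \<times> UNIV) \<Longrightarrow> v \<in> lists (Xs \<times> UNIV) \<Longrightarrow> x \<in> Xs \<Longrightarrow>
    (u @ [(x, b), (x, \<not> b)] @ v, u @ v) \<in> pres_rel Xs R"
| relator: "u \<in> lists (Xs \<times> UNIV) \<Longrightarrow> v \<in> lists (Xs \<times> UNIV) \<Longrightarrow> r \<in> R \<inter> lists (Xs \<times> UNIV) \<Longrightarrow>
    (u @ r @ v, u @ v) \<in> pres_rel Xs R"

definition presented_group :: "'g set \<Rightarrow> 'g word set \<Rightarrow> 'g word set monoid" where
  "presented_group Xs R =
     \<lparr>carrier = lists (Xs \<times> UNIV) // pres_rel Xs R,
      monoid.mult = (\<lambda>A B. \<Union>a \<in> A. \<Union>b \<in> B. pres_rel Xs R `` {a @ b}),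
      one = pres_rel Xs R `` {[]}\<rparr>"

text \<open>Relators \<open>(\<sigma>\<^sub>i \<cdots> \<sigma>\<^sub>j)\<^sup>2\<close> for \<open>1 \<le> i < j \<le> n - 1\<close>.\<close>

definition string_relators :: "nat \<Rightarrow> nat word set" where
  "string_relators n =
     {concat (replicate 2 (map (\<lambda>k. (k, True)) [i..<Suc j])) | i j. 1 \<le> i \<and> i < j \<and> j \<le> n - 1}"

text \<open>For \<open>p i = 0\<close> (that is, \<open>p\<^sub>i = \<infinity>\<close>) the power relator is the empty word.\<close>

definition coxeter_rot_relators :: "nat \<Rightarrow> (nat \<Rightarrow> nat) \<Rightarrow> nat word set" where
  "coxeter_rot_relators n p =
     {replicate (p i) (i, True) | i. i \<in> {1..n - 1}} \<union> string_relators n"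

definition Wplus :: "nat \<Rightarrow> nat word set monoid" where
  "Wplus n = presented_group {1..n - 1} (string_relators n)"

definition Wplus_gen :: "nat \<Rightarrow> nat \<Rightarrow> nat word set" where
  "Wplus_gen n i = pres_rel {1..n - 1} (string_relators n) `` {[(i, True)]}"

fun bar_letter :: "nat \<times> bool \<Rightarrow> nat word" where
  "bar_letter (i, b) =
     (if i = 1 then [(1, \<not> b)]
      else if i = 2 then (if b then [(1, True), (1, True), (2, True)]
                          else [(2, False), (1, False), (1, False)])
      else [(i, b)])"

definition bar_word :: "nat word \<Rightarrow> nat word" where
  "bar_word w = concat (map bar_letter w)"

definition Wplus_bar :: "nat \<Rightarrow> nat word set \<Rightarrow> nat word set" where
  "Wplus_bar n A = pres_rel {1..n - 1} (string_relators n) `` (bar_word ` A)"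

text \<open>\<open>G = W\<^sup>+/N\<close> for a group \<open>G\<close> with specified generators \<open>x 1, \<dots>, x (n - 1)\<close>.  The epimorphism
  is determined on the carrier by its values on the generators, hence so is \<open>N\<close>.\<close>

definition Wplus_quotient ::
  "nat \<Rightarrow> 'b monoid \<Rightarrow> (nat \<Rightarrow> 'b) \<Rightarrow> nat word set set \<Rightarrow> bool" where
  "Wplus_quotient n G x N \<longleftrightarrow>
     (\<exists>h \<in> epi (Wplus n) G.
        (\<forall>i \<in> {1..n - 1}. h (Wplus_gen n i) = x i) \<and> N = kernel (Wplus n) G h)"


section \<open>Mix and comix\<close>

definition mix :: "'i set \<Rightarrow> 'b monoid \<Rightarrow> ('i \<Rightarrow> 'b) \<Rightarrow> 'c monoid \<Rightarrow> ('i \<Rightarrow> 'c) \<Rightarrow> ('b \<times> 'c) monoid"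
  where "mix I G x H y = subgroup_generated (G \<times>\<times> H) ((\<lambda>i. (x i, y i)) ` I)"

text \<open>Comix of the groups with presentations \<open>\<langle>Xs | R\<rangle>\<close> and \<open>\<langle>Xs | S\<rangle>\<close>; the second copy \<open>x'\<close> of a
  generator \<open>x\<close> is \<open>Inr x\<close>.\<close>

definition comix :: "'g set \<Rightarrow> 'g word set \<Rightarrow> 'g word set \<Rightarrow> ('g + 'g) word set monoid" where
  "comix Xs R S =
     presented_group (Xs <+> Xs)
       (map (map_prod Inl id) ` R \<union> map (map_prod Inr id) ` S \<union>
        {[(Inl x, False), (Inr x, True)] | x. x \<in> Xs})"

definition polytope_mix_group ::
  "nat \<Rightarrow> 'a based_poset \<Rightarrow> 'b based_poset \<Rightarrow> (('a \<Rightarrow> 'a) \<times> ('b \<Rightarrow> 'b)) monoid" where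
  "polytope_mix_group n P Q =
     mix {1..n - 1} (aut_group P) (rot_gen P) (aut_group Q) (rot_gen Q)"

text \<open>Chirality of the pre-polytope \<open>P \<diamond> Q\<close> for chiral \<open>P\<close> and \<open>Q\<close> of rank \<open>n\<close>, read off
  from \<open>\<Gamma>\<^sup>+(P \<diamond> Q) = \<Gamma>\<^sup>+(P) \<diamond> \<Gamma>\<^sup>+(Q) = W\<^sup>+/N\<close>.\<close>

definition mix_chiral :: "nat \<Rightarrow> 'a based_poset \<Rightarrow> 'b based_poset \<Rightarrow> bool" where
  "mix_chiral n P Q \<longleftrightarrow>
     (\<exists>N. Wplus_quotient n (polytope_mix_group n P Q) (\<lambda>i. (rot_gen P i, rot_gen Q i)) N \<and>
          Wplus_bar n ` N \<noteq> N)"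

text \<open>The order of a possibly infinite group.  In \<open>ennreal\<close> one has \<open>\<infinity> / \<infinity> = 0\<close>, so a strict
  lower bound on a quotient of orders forces the denominator to be finite.\<close>

definition ecard :: "'a set \<Rightarrow> ennreal" where
  "ecard A = (if finite A then of_nat (card A) else \<infinity>)"

end

theory Submission
  imports Defs
begin

text \<open>
  Write \<open>x\<close> and \<open>y\<close> for the rotations of \<open>P\<close> and of its dual at the base flag and \<open>xb\<close>, \<open>yb\<close> for those
  of their mirror images; evaluating a word at \<open>xb\<close> is evaluating its bar at \<open>x\<close>.  Suppose that the
  kernel of \<open>w \<mapsto> (w(x), w(y))\<close> is invariant under the bar operation.  Then the image of
  \<open>w \<mapsto> (w(x), w(xb), w(y), w(yb))\<close> projects injectively to \<open>\<Gamma>\<^sup>2\<close>.  On the other hand, by Goursat's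
  lemma it has index at most the order of the comix in \<open>K \<times> L\<close>, where \<open>K = \<langle>(x, xb)\<rangle>\<close> and
  \<open>L = \<langle>(y, yb)\<rangle>\<close> are quotients of the rotation groups of the Coxeter groups of the type of \<open>P\<close> and of
  the reversed type.  Up to inverting and reversing the generators, \<open>L\<close> is \<open>K\<close> with its second
  coordinate conjugated by an automorphism mapping the \<open>0\<close>-adjacent base flag to the
  \<open>(n-1)\<close>-adjacent one.  Hence \<open>|K|\<^sup>2 \<le> |\<Gamma>|\<^sup>2 c\<close> with \<open>c\<close> the order of the comix.
\<close>

section \<open>Words and presentations\<close>

fun word_eval :: "('a, 'm) monoid_scheme \<Rightarrow> ('i \<Rightarrow> 'a) \<Rightarrow> 'i word \<Rightarrow> 'a" where
  "word_eval G x [] = \<one>\<^bsub>G\<^esub>"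
| "word_eval G x ((i, b) # w) = (if b then x i else inv\<^bsub>G\<^esub> x i) \<otimes>\<^bsub>G\<^esub> word_eval G x w"

lemma word_eval_map_gen: "word_eval G x (map (map_prod f id) w) = word_eval G (x \<circ> f) w"
  by (induction w) auto

context group
begin

lemma word_eval_closed:
  assumes "x \<in> I \<rightarrow> carrier G" "w \<in> lists (I \<times> UNIV)"
  shows "word_eval G x w \<in> carrier G"
  using assms(2,1) by (induction w) (auto simp: Pi_iff)

lemma word_eval_append:
  assumes "x \<in> I \<rightarrow> carrier G" "u \<in> lists (I \<times> UNIV)" "v \<in> lists (I \<times> UNIV)"
  shows "word_eval G x (u @ v) = word_eval G x u \<otimes> word_eval G x v"
  using assms(2,1,3)
proof (induction u)
  case Nil
  then show ?case by (simp add: word_eval_closed)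
next
  case (Cons a u)
  obtain i b where a: "a = (i, b)" by (cases a)
  have "x i \<in> carrier G" using Cons a by auto
  moreover have "word_eval G x u \<in> carrier G" "word_eval G x v \<in> carrier G"
    using Cons by (auto intro: word_eval_closed)
  ultimately show ?case using Cons a by (auto simp: m_assoc)
qed

lemma word_eval_inverse:
  assumes x: "x \<in> I \<rightarrow> carrier G" and w: "w \<in> lists (I \<times> UNIV)"
  shows "word_eval G x (rev (map (apsnd Not) w)) = inv (word_eval G x w)"
  using w
proof (induction w)
  case Nil
  then show ?case by simp
next
  case (Cons a w)
  obtain i b where a: "a = (i, b)" by (cases a)
  have xi: "x i \<in> carrier G" and i: "i \<in> I" using Cons a x by auto
  have "rev (map (apsnd Not) w) \<in> lists (I \<times> UNIV)" using Cons by (auto simp: in_lists_conv_set)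
  then have "word_eval G x (rev (map (apsnd Not) w) @ [(i, \<not> b)])
     = word_eval G x (rev (map (apsnd Not) w)) \<otimes> word_eval G x [(i, \<not> b)]"
    using i by (intro word_eval_append[OF x]) auto
  then show ?case using Cons a xi word_eval_closed[OF x, of w] by (auto simp: inv_mult_group)
qed

text \<open>Substituting words for letters is a change of generators. With \<open>bar_letter\<close>
  for \<open>s\<close>, the bar of a word at the rotations of one flag becomes the word itself at
  the rotations of the \<open>0\<close>-adjacent flag.\<close>

lemma word_eval_subst:
  assumes x: "x \<in> I \<rightarrow> carrier G"
    and s: "\<And>i b. i \<in> I \<Longrightarrow> s (i, b) \<in> lists (I \<times> UNIV)"
    and e: "\<And>i b. i \<in> I \<Longrightarrow> word_eval G x (s (i, b)) = (if b then z i else inv (z i))"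
    and w: "w \<in> lists (I \<times> UNIV)"
  shows "word_eval G x (concat (map s w)) = word_eval G z w"
  using w
proof (induction w)
  case Nil
  then show ?case by simp
next
  case (Cons a w)
  obtain i b where a: "a = (i, b)" by (cases a)
  have "concat (map s w) \<in> lists (I \<times> UNIV)"
    using Cons(2) s by (force simp: in_lists_conv_set)
  then have "word_eval G x (s a @ concat (map s w)) = word_eval G x (s a) \<otimes> word_eval G x (concat (map s w))"
    using Cons a s by (intro word_eval_append[OF x]) auto
  then show ?case using Cons a e by auto
qed

text \<open>Turns the carrier of a mix, which is defined as a generated subgroup, into a set of
  values of words.\<close>

lemma generate_eq_word_eval:
  assumes x: "x \<in> I \<rightarrow> carrier G"
  shows "generate G (x ` I) = word_eval G x ` lists (I \<times> UNIV)"
proof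
  show "word_eval G x ` lists (I \<times> UNIV) \<subseteq> generate G (x ` I)"
  proof (rule image_subsetI)
    show "word_eval G x w \<in> generate G (x ` I)" if "w \<in> lists (I \<times> UNIV)" for w
      using that
    proof (induction w)
      case (Cons a w)
      obtain i b where a: "a = (i, b)" by (cases a)
      then have "x i \<in> x ` I" using Cons by auto
      then have "(if b then x i else inv x i) \<in> generate G (x ` I)"
        by (simp add: generate.incl generate.inv)
      then show ?case using Cons a by (simp add: generate.eng)
    qed (simp add: generate.one)
  qed
  show "generate G (x ` I) \<subseteq> word_eval G x ` lists (I \<times> UNIV)"
  proof
    fix g assume "g \<in> generate G (x ` I)"
    then show "g \<in> word_eval G x ` lists (I \<times> UNIV)"
    proof induction
      case one
      show ?case by (rule image_eqI[of _ _ "[]"]) auto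
    next
      case (incl h)
      then obtain i where "h = x i" "i \<in> I" by auto
      then show ?case using x by (intro image_eqI[of _ _ "[(i, True)]"]) (auto simp: Pi_iff)
    next
      case (inv h)
      then obtain i where "h = x i" "i \<in> I" by auto
      then show ?case using x by (intro image_eqI[of _ _ "[(i, False)]"]) (auto simp: Pi_iff)
    next
      case (eng h1 h2)
      then obtain u v where "h1 = word_eval G x u" "h2 = word_eval G x v"
        "u \<in> lists (I \<times> UNIV)" "v \<in> lists (I \<times> UNIV)" by auto
      then show ?case using word_eval_append[OF x, of u v]
        by (intro image_eqI[of _ _ "u @ v"]) auto
    qed
  qed
qed

lemma word_eval_subgroup_generated:
  assumes x: "x \<in> I \<rightarrow> carrier G" and w: "w \<in> lists (I \<times> UNIV)"
  shows "word_eval (subgroup_generated G (x ` I)) x w = word_eval G x w"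
  using w
proof (induction w)
  case Nil
  then show ?case by (simp add: subgroup_generated_def)
next
  case (Cons a w)
  obtain i b where a: "a = (i, b)" by (cases a)
  have "x i \<in> carrier (subgroup_generated G (x ` I))"
    using x Cons a by (auto intro!: subsetD[OF subgroup_generated_subset_carrier_subset])
  then show ?case using Cons a by auto
qed

text \<open>The heart of von Dyck's theorem: a cancelling pair and a relator both evaluate to
  \<open>\<one>\<close>, so inserting them anywhere in a word does not change its value.\<close>

lemma word_eval_pres_rel:
  assumes x: "x \<in> Xs \<rightarrow> carrier G"
    and R: "\<And>r. r \<in> R \<Longrightarrow> r \<in> lists (Xs \<times> UNIV) \<Longrightarrow> word_eval G x r = \<one>"
    and uv: "(u, v) \<in> pres_rel Xs R"
  shows "word_eval G x u = word_eval G x v"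
  using uv
proof induction
  case (cancel u v y b)
  have y: "x y \<in> carrier G" using cancel x by auto
  have l: "[(y, b), (y, \<not> b)] \<in> lists (Xs \<times> UNIV)" using cancel by auto
  have "word_eval G x (u @ [(y, b), (y, \<not> b)] @ v)
      = word_eval G x u \<otimes> (word_eval G x [(y, b), (y, \<not> b)] \<otimes> word_eval G x v)"
    using cancel l by (subst word_eval_append[OF x], simp, simp, subst word_eval_append[OF x]) auto
  moreover have "word_eval G x [(y, b), (y, \<not> b)] = \<one>" using y by auto
  ultimately show ?case using cancel by (simp add: word_eval_closed[OF x] word_eval_append[OF x])
next
  case (relator u v r)
  have "word_eval G x (u @ r @ v)
      = word_eval G x u \<otimes> (word_eval G x r \<otimes> word_eval G x v)"
    using relator by (subst word_eval_append[OF x], simp, simp, subst word_eval_append[OF x]) auto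
  then show ?case using relator R by (simp add: word_eval_closed[OF x] word_eval_append[OF x])
qed auto

end

lemma word_eval_hom:
  assumes "group_hom G H h" "x \<in> I \<rightarrow> carrier G" "w \<in> lists (I \<times> UNIV)"
  shows "h (word_eval G x w) = word_eval H (h \<circ> x) w"
proof -
  interpret group_hom G H h by fact
  show ?thesis using assms(3)
  proof (induction w)
    case (Cons a w)
    obtain i b where a: "a = (i, b)" by (cases a)
    have "x i \<in> carrier G" using Cons a assms(2) by auto
    then show ?case using Cons a assms(2) by (simp add: G.word_eval_closed[OF assms(2)])
  qed simp
qed

lemma word_eval_DirProd:
  assumes "group G" "group H" "x \<in> I \<rightarrow> carrier G" "y \<in> I \<rightarrow> carrier H" "w \<in> lists (I \<times> UNIV)"
  shows "word_eval (G \<times>\<times> H) (\<lambda>i. (x i, y i)) w = (word_eval G x w, word_eval H y w)"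
  using assms(5)
proof (induction w)
  case (Cons a w)
  obtain i b where a: "a = (i, b)" by (cases a)
  have "x i \<in> carrier G" "y i \<in> carrier H" using Cons a assms by auto
  then show ?case using Cons a assms by (simp add: inv_DirProd)
qed simp

text \<open>Meaningful only if \<open>x\<close> satisfies the relators, since then all representatives of a class have
  the same value.\<close>

definition pres_hom :: "('b, 'm) monoid_scheme \<Rightarrow> ('i \<Rightarrow> 'b) \<Rightarrow> 'i word set \<Rightarrow> 'b" where
  "pres_hom G x A = word_eval G x (SOME w. w \<in> A)"

lemma pres_rel_lists:
  "(u, v) \<in> pres_rel Xs R \<Longrightarrow> u \<in> lists (Xs \<times> UNIV) \<and> v \<in> lists (Xs \<times> UNIV)"
  by (induction rule: pres_rel.induct) auto

lemma pres_class_self: "w \<in> lists (Xs \<times> UNIV) \<Longrightarrow> w \<in> pres_rel Xs R `` {w}"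
  by (auto intro: pres_rel.refl)

text \<open>The setting of von Dyck's theorem, used twice: for the comix, mapped onto a factor
  group, and for \<open>Wplus\<close>, mapped onto the mix of a polytope with its dual.\<close>

locale von_dyck = group G for G (structure) +
  fixes Xs :: "'i set" and R :: "'i word set" and x :: "'i \<Rightarrow> 'a"
  assumes gen: "x \<in> Xs \<rightarrow> carrier G"
    and relators: "r \<in> R \<Longrightarrow> r \<in> lists (Xs \<times> UNIV) \<Longrightarrow> word_eval G x r = \<one>"
begin

lemma pres_rel_eval: "(u, v) \<in> pres_rel Xs R \<Longrightarrow> word_eval G x u = word_eval G x v"
  by (rule word_eval_pres_rel[OF gen relators])

lemma pres_hom_eq:
  assumes "A \<in> carrier (presented_group Xs R)" "w \<in> A"
  shows "pres_hom G x A = word_eval G x w"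
proof -
  from assms obtain u where u: "A = pres_rel Xs R `` {u}"
    by (auto simp: presented_group_def quotient_def)
  have "(SOME w. w \<in> A) \<in> A" using assms(2) by (rule someI)
  then have "(u, SOME w. w \<in> A) \<in> pres_rel Xs R" "(u, w) \<in> pres_rel Xs R"
    using assms(2) unfolding u by blast+
  then have "word_eval G x u = word_eval G x (SOME w. w \<in> A)" "word_eval G x u = word_eval G x w"
    by (blast intro: pres_rel_eval)+
  then show ?thesis by (simp add: pres_hom_def)
qed

lemma class_in_carrier:
  "w \<in> lists (Xs \<times> UNIV) \<Longrightarrow> pres_rel Xs R `` {w} \<in> carrier (presented_group Xs R)"
  by (auto simp: presented_group_def quotient_def)

lemma pres_hom_class:
  "w \<in> lists (Xs \<times> UNIV) \<Longrightarrow> pres_hom G x (pres_rel Xs R `` {w}) = word_eval G x w"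
  by (rule pres_hom_eq[OF class_in_carrier pres_class_self])

lemma pres_hom_image: "pres_hom G x ` carrier (presented_group Xs R) = word_eval G x ` lists (Xs \<times> UNIV)"
proof -
  have "carrier (presented_group Xs R) = (\<lambda>w. pres_rel Xs R `` {w}) ` lists (Xs \<times> UNIV)"
    by (auto simp: presented_group_def quotient_def)
  then show ?thesis by (simp add: image_image pres_hom_class cong: image_cong)
qed

lemma pres_hom_hom: "pres_hom G x \<in> hom (presented_group Xs R) G"
proof (rule homI)
  show "pres_hom G x A \<in> carrier G" if "A \<in> carrier (presented_group Xs R)" for A
  proof -
    have "pres_hom G x A \<in> word_eval G x ` lists (Xs \<times> UNIV)" using that pres_hom_image by blast
    then obtain w where "w \<in> lists (Xs \<times> UNIV)" "pres_hom G x A = word_eval G x w" by (elim imageE)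
    then show ?thesis by (simp only: word_eval_closed[OF gen])
  qed
next
  fix A B assume A: "A \<in> carrier (presented_group Xs R)" and B: "B \<in> carrier (presented_group Xs R)"
  have ne: "\<exists>a. a \<in> C \<and> a \<in> lists (Xs \<times> UNIV)" if "C \<in> carrier (presented_group Xs R)" for C
    using that pres_class_self[of _ Xs R] by (auto simp: presented_group_def quotient_def)
  have sub: "a \<in> lists (Xs \<times> UNIV)" if "C \<in> carrier (presented_group Xs R)" "a \<in> C" for C a
    using that by (auto simp: presented_group_def quotient_def dest: pres_rel_lists)
  let ?M = "A \<otimes>\<^bsub>presented_group Xs R\<^esub> B"
  have M: "?M = (\<Union>a \<in> A. \<Union>b \<in> B. pres_rel Xs R `` {a @ b})" by (simp add: presented_group_def)
  obtain a b where ab: "a \<in> A" "b \<in> B" "a \<in> lists (Xs \<times> UNIV)" "b \<in> lists (Xs \<times> UNIV)"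
    using ne[OF A] ne[OF B] by (elim exE conjE) (rule that)
  have "a @ b \<in> ?M" using ab pres_class_self[of "a @ b" Xs R] unfolding M by auto
  then have "(SOME w. w \<in> ?M) \<in> ?M" by (rule someI)
  \<comment> \<open>The word chosen by \<open>pres_hom\<close> for the product class need not be a
    concatenation. It is equivalent to some \<open>c @ d\<close> with factors in \<open>A\<close>
    and \<open>B\<close>, and equivalent words have equal values.\<close>
  then obtain c d where cd: "c \<in> A" "d \<in> B" "(c @ d, SOME w. w \<in> ?M) \<in> pres_rel Xs R"
    unfolding M by auto
  have "pres_hom G x ?M = word_eval G x (c @ d)"
    unfolding pres_hom_def using pres_rel_eval[OF cd(3)] by simp
  also have "\<dots> = word_eval G x c \<otimes> word_eval G x d"
    using cd sub A B by (intro word_eval_append[OF gen]) auto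
  also have "\<dots> = pres_hom G x A \<otimes> pres_hom G x B"
    using cd A B by (simp add: pres_hom_eq)
  finally show "pres_hom G x ?M = pres_hom G x A \<otimes> pres_hom G x B" .
qed

end

text \<open>Goursat: with \<open>K = {k(w) | l(w) = 1}\<close> the image of \<open>(k, l)\<close> has order \<open>|K| |H|\<close>, and \<open>G/K\<close> is a
  common quotient of both groups, hence of the comix.\<close>

lemma card_mult_le_joint_image_times_comix:
  fixes G (structure) and H :: "('b, 'm) monoid_scheme" and I :: "'i set"
  defines "W \<equiv> lists (I \<times> (UNIV::bool set))"
  assumes G: "group G" "finite (carrier G)" and k: "k \<in> I \<rightarrow> carrier G"
    and Gk: "carrier G = word_eval G k ` W"
    and H: "group H" "finite (carrier H)" and l: "l \<in> I \<rightarrow> carrier H"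
    and Hl: "carrier H = word_eval H l ` W"
    and R: "\<And>r. r \<in> R \<Longrightarrow> r \<in> W \<Longrightarrow> word_eval G k r = \<one>"
    and S: "\<And>r. r \<in> S \<Longrightarrow> r \<in> W \<Longrightarrow> word_eval H l r = \<one>\<^bsub>H\<^esub>"
    and fin: "finite (carrier (comix I R S))"
  shows "card (carrier G) * card (carrier H)
    \<le> card ((\<lambda>w. (word_eval G k w, word_eval H l w)) ` W) * card (carrier (comix I R S))"
proof -
  interpret G: group G by fact
  interpret H: group H by fact
  note kc = G.word_eval_closed[OF k, folded W_def] and lc = H.word_eval_closed[OF l, folded W_def]
  note ka = G.word_eval_append[OF k, folded W_def] and la = H.word_eval_append[OF l, folded W_def]
  note ki = G.word_eval_inverse[OF k, folded W_def] and li = H.word_eval_inverse[OF l, folded W_def]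
  have Wa: "u @ v \<in> W" if "u \<in> W" "v \<in> W" for u v using that by (simp add: W_def)
  have Wi: "rev (map (apsnd Not) u) \<in> W" if "u \<in> W" for u
    using that by (auto simp: W_def in_lists_conv_set)
  have WN: "[] \<in> W" by (simp add: W_def)
  define K where "K = word_eval G k ` {w \<in> W. word_eval H l w = \<one>\<^bsub>H\<^esub>}"
  have KE: "\<exists>w. w \<in> W \<and> word_eval H l w = \<one>\<^bsub>H\<^esub> \<and> a = word_eval G k w" if "a \<in> K" for a
    using that by (auto simp: K_def)
  have KI: "word_eval G k w \<in> K" if "w \<in> W" "word_eval H l w = \<one>\<^bsub>H\<^esub>" for w
    using that by (auto simp: K_def)
  have "subgroup K G"
  proof (rule G.subgroupI)
    show "K \<subseteq> carrier G" using kc by (auto simp: K_def)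
    show "K \<noteq> {}" using KI[OF WN] by auto
    show "inv a \<in> K" if "a \<in> K" for a
    proof -
      obtain w where w: "w \<in> W" "word_eval H l w = \<one>\<^bsub>H\<^esub>" "a = word_eval G k w"
        using KE[OF \<open>a \<in> K\<close>] by blast
      then show ?thesis using KI[OF Wi[OF w(1)]] ki[OF w(1)] li[OF w(1)] by simp
    qed
    show "a \<otimes> b \<in> K" if "a \<in> K" "b \<in> K" for a b
    proof -
      obtain u where u: "u \<in> W" "word_eval H l u = \<one>\<^bsub>H\<^esub>" "a = word_eval G k u"
        using KE[OF \<open>a \<in> K\<close>] by blast
      obtain v where v: "v \<in> W" "word_eval H l v = \<one>\<^bsub>H\<^esub>" "b = word_eval G k v"
        using KE[OF \<open>b \<in> K\<close>] by blast
      show ?thesis using KI[OF Wa[OF u(1) v(1)]] ka[OF u(1) v(1)] la[OF u(1) v(1)] u v by simp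
    qed
  qed
  \<comment> \<open>Every element of \<open>G\<close> is the value of a word, so conjugation can be
    carried out on words, where it preserves triviality under \<open>l\<close>.\<close>
  moreover have "x \<otimes> h \<otimes> inv x \<in> K" if x: "x \<in> carrier G" and h: "h \<in> K" for x h
  proof -
    obtain u where u: "u \<in> W" "word_eval H l u = \<one>\<^bsub>H\<^esub>" "h = word_eval G k u"
      using KE[OF h] by blast
    obtain v where v: "v \<in> W" "x = word_eval G k v" using x Gk by auto
    show ?thesis
      using KI[OF Wa[OF Wa[OF v(1) u(1)] Wi[OF v(1)]]] ka[OF Wa[OF v(1) u(1)] Wi[OF v(1)]]
        la[OF Wa[OF v(1) u(1)] Wi[OF v(1)]] ka[OF v(1) u(1)] la[OF v(1) u(1)] ki[OF v(1)] li[OF v(1)]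
        u v lc[OF v(1)] by simp
  qed
  ultimately have "K \<lhd> G" by (simp add: G.normal_inv_iff)
  then interpret K: normal K G .
  define F where "F = G Mod K"
  interpret F: group F unfolding F_def by (rule K.factorgroup_is_group)
  interpret pi: group_hom G F "\<lambda>a. K #> a"
    using K.r_coset_hom_Mod by unfold_locales (simp add: F_def)
  \<comment> \<open>Both copies of the generator \<open>i\<close> go to the coset of
    \<open>k i\<close>. The relators from \<open>R\<close> hold already in \<open>G\<close>; those
    from \<open>S\<close> are trivial under \<open>l\<close>, so their values under \<open>k\<close>
    lie in \<open>K\<close>.\<close>
  define z where "z = case_sum (\<lambda>i. K #> k i) (\<lambda>i. K #> k i)"
  have zk: "(\<lambda>i. K #> k i) \<in> I \<rightarrow> carrier F" using k by (auto simp: Pi_iff)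
  have ev: "word_eval F (\<lambda>i. K #> k i) w = K #> word_eval G k w" if "w \<in> W" for w
    using word_eval_hom[OF pi.group_hom_axioms k that[unfolded W_def]] by (simp add: comp_def)
  have zInl: "z \<circ> Inl = (\<lambda>i. K #> k i)" and zInr: "z \<circ> Inr = (\<lambda>i. K #> k i)"
    by (auto simp: z_def)
  let ?Rel = "map (map_prod Inl id) ` R \<union> map (map_prod Inr id) ` S \<union> {[(Inl x, False), (Inr x, True)] | x. x \<in> I}"
  interpret D: von_dyck F "I <+> I" ?Rel z
  proof
    show "z \<in> I <+> I \<rightarrow> carrier F" using zk by (auto simp: z_def Pi_iff)
    fix r assume r: "r \<in> ?Rel" "r \<in> lists ((I <+> I) \<times> UNIV)"
    from r(1) consider s where "s \<in> R" "r = map (map_prod Inl id) s"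
      | s where "s \<in> S" "r = map (map_prod Inr id) s"
      | x where "x \<in> I" "r = [(Inl x, False), (Inr x, True)]" by blast
    then show "word_eval F z r = \<one>\<^bsub>F\<^esub>"
    proof cases
      case (1 s)
      have s: "s \<in> W" using r(2) 1 by (fastforce simp: W_def in_lists_conv_set)
      then show ?thesis using 1 R[OF 1(1) s] by (simp add: word_eval_map_gen zInl ev)
    next
      case (2 s)
      have s: "s \<in> W" using r(2) 2 by (fastforce simp: W_def in_lists_conv_set)
      have "K #> word_eval G k s = K"
        using KI[OF s S[OF 2(1) s]] by (simp add: K.rcos_const)
      moreover have "\<one>\<^bsub>F\<^esub> = K" by (simp add: F_def FactGroup_def)
      ultimately show ?thesis using s 2 by (simp add: word_eval_map_gen zInr ev)
    next
      case (3 x)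
      then show ?thesis using zk by (simp add: z_def Pi_iff)
    qed
  qed
  \<comment> \<open>Words in the first copy of the generators already reach every coset, so the
    index of \<open>K\<close> is at most the order of the comix.\<close>
  have cf: "carrier F \<subseteq> pres_hom F z ` carrier (comix I R S)"
  proof
    fix c assume "c \<in> carrier F"
    then obtain a where "a \<in> carrier G" "c = K #> a" by (auto simp: F_def FactGroup_def RCOSETS_def)
    then obtain w where w: "w \<in> W" "c = K #> word_eval G k w" using Gk by auto
    have "map (map_prod Inl id) w \<in> lists ((I <+> I) \<times> UNIV)"
      using w(1) by (auto simp: W_def in_lists_conv_set)
    moreover have "c = word_eval F z (map (map_prod Inl id) w)"
      using w by (simp add: word_eval_map_gen zInl ev)
    ultimately show "c \<in> pres_hom F z ` carrier (comix I R S)"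
      unfolding comix_def D.pres_hom_image by blast
  qed
  have "card (rcosets K) \<le> card (carrier (comix I R S))"
    using card_mono[OF finite_imageI[OF fin] cf] card_image_le[OF fin, of "pres_hom F z"]
    by (simp add: F_def FactGroup_def)
  moreover have "card (rcosets K) * card K = card (carrier G)"
    using G.lagrange[OF \<open>subgroup K G\<close>] by (simp add: order_def)
  ultimately have 1: "card (carrier G) \<le> card (carrier (comix I R S)) * card K"
    by (metis mult_le_mono1)
  define s where "s b = (SOME w. w \<in> W \<and> word_eval H l w = b)" for b
  have s: "s b \<in> W" "word_eval H l (s b) = b" if "b \<in> carrier H" for b
  proof -
    have "\<exists>w. w \<in> W \<and> word_eval H l w = b" using that Hl by auto
    then have "s b \<in> W \<and> word_eval H l (s b) = b" unfolding s_def by (rule someI_ex)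
    then show "s b \<in> W" "word_eval H l (s b) = b" by auto
  qed
  let ?Q = "(\<lambda>w. (word_eval G k w, word_eval H l w)) ` W"
  let ?f = "\<lambda>(a, b). (a \<otimes> word_eval G k (s b), b)"
  have "?Q \<subseteq> carrier G \<times> carrier H" using kc lc by auto
  then have finQ: "finite ?Q" by (rule finite_subset) (use G H in simp)
  have Kc: "K \<subseteq> carrier G" using \<open>subgroup K G\<close> subgroup.subset by auto
  have inj: "inj_on ?f (K \<times> carrier H)"
    using Kc kc s by (auto simp: inj_on_def)
  have img: "?f ` (K \<times> carrier H) \<subseteq> ?Q"
  proof (clarify)
    fix a b assume a: "a \<in> K" and b: "b \<in> carrier H"
    obtain u where u: "u \<in> W" "word_eval H l u = \<one>\<^bsub>H\<^esub>" "a = word_eval G k u"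
      using KE[OF a] by blast
    show "(a \<otimes> word_eval G k (s b), b) \<in> ?Q"
      using ka[OF u(1) s(1)[OF b]] la[OF u(1) s(1)[OF b]] u s(2)[OF b] b
      by (intro image_eqI[OF _ Wa[OF u(1) s(1)[OF b]]]) simp
  qed
  have "card K * card (carrier H) \<le> card ?Q"
    using card_inj_on_le[OF inj img finQ] by (simp add: card_cartesian_product)
  then have 2: "card (carrier (comix I R S)) * (card K * card (carrier H)) \<le> card (carrier (comix I R S)) * card ?Q"
    by (rule mult_le_mono2)
  have "card (carrier G) * card (carrier H) \<le> card (carrier (comix I R S)) * card K * card (carrier H)"
    by (rule mult_le_mono1[OF 1])
  also have "\<dots> \<le> card (carrier (comix I R S)) * card ?Q"
    using 2 by (simp only: mult.assoc)
  finally show ?thesis by (simp only: mult.commute)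
qed

section \<open>Mixes, conjugation and letterwise translation of words\<close>

lemma word_eval_mix:
  fixes G :: "'a monoid" and H :: "'b monoid"
  assumes G: "group G" and H: "group H" and x: "x \<in> I \<rightarrow> carrier G" and y: "y \<in> I \<rightarrow> carrier H"
  shows "group (mix I G x H y)"
    and "(\<lambda>i. (x i, y i)) \<in> I \<rightarrow> carrier (mix I G x H y)"
    and "w \<in> lists (I \<times> UNIV) \<Longrightarrow>
      word_eval (mix I G x H y) (\<lambda>i. (x i, y i)) w = (word_eval G x w, word_eval H y w)"
    and "carrier (mix I G x H y) = (\<lambda>w. (word_eval G x w, word_eval H y w)) ` lists (I \<times> UNIV)"
    and "\<one>\<^bsub>mix I G x H y\<^esub> = (\<one>\<^bsub>G\<^esub>, \<one>\<^bsub>H\<^esub>)"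
proof -
  interpret G: group G by fact
  interpret H: group H by fact
  interpret GH: group "G \<times>\<times> H" by (rule DirProd_group) unfold_locales
  let ?z = "\<lambda>i. (x i, y i)"
  have z: "?z \<in> I \<rightarrow> carrier (G \<times>\<times> H)" using x y by (auto simp: Pi_iff)
  then have Int: "carrier (G \<times>\<times> H) \<inter> ?z ` I = ?z ` I" by blast
  show "group (mix I G x H y)" unfolding mix_def by (rule GH.group_subgroup_generated)
  show "?z \<in> I \<rightarrow> carrier (mix I G x H y)"
    unfolding mix_def carrier_subgroup_generated Int by (auto intro: generate.incl)
  show "word_eval (mix I G x H y) ?z w = (word_eval G x w, word_eval H y w)" if "w \<in> lists (I \<times> UNIV)"
    unfolding mix_def GH.word_eval_subgroup_generated[OF z that]
    by (rule word_eval_DirProd[OF G H x y that])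
  show "carrier (mix I G x H y) = (\<lambda>w. (word_eval G x w, word_eval H y w)) ` lists (I \<times> UNIV)"
    unfolding mix_def carrier_subgroup_generated Int GH.generate_eq_word_eval[OF z]
    using word_eval_DirProd[OF G H x y] by (rule image_cong[OF HOL.refl])
  show "\<one>\<^bsub>mix I G x H y\<^esub> = (\<one>\<^bsub>G\<^esub>, \<one>\<^bsub>H\<^esub>)" by (simp add: mix_def)
qed

lemma (in group) conjugation_group_hom:
  assumes "g \<in> carrier G" shows "group_hom G G (\<lambda>a. inv g \<otimes> a \<otimes> g)"
proof -
  have "inv g \<otimes> (a \<otimes> b) \<otimes> g = inv g \<otimes> a \<otimes> g \<otimes> (inv g \<otimes> b \<otimes> g)"
    if "a \<in> carrier G" "b \<in> carrier G" for a b
    using that assms by (simp add: m_assoc) (simp add: m_assoc[symmetric])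
  then show ?thesis using assms by unfold_locales (auto intro!: homI)
qed

lemma (in group) word_eval_replicate:
  "x i \<in> carrier G \<Longrightarrow> word_eval G x (replicate m (i, True)) = x i [^] m"
  by (induction m) (auto simp: nat_pow_Suc2[symmetric])

text \<open>With \<open>n - i\<close> for \<open>f i\<close> the word map is the automorphism
  \<delta> on words, which exchanges the rotations of a polytope and those of its dual. The order of
  the letters is kept; only indices and exponents change.\<close>

lemma (in group) word_eval_reverse_invert:
  assumes "\<And>i. i \<in> I \<Longrightarrow> y (f i) = inv (x i)" "x \<in> I \<rightarrow> carrier G" "w \<in> lists (I \<times> UNIV)"
  shows "word_eval G y (map (\<lambda>(i, b). (f i, \<not> b)) w) = word_eval G x w"
  using assms(3,1,2) by (induction w) (auto simp: Pi_iff)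


lemma bar_word_lists:
  assumes n: "2 \<le> n" and w: "w \<in> lists ({1..n - 1} \<times> UNIV)"
  shows "bar_word w \<in> lists ({1..n - 1} \<times> UNIV)"
proof -
  have "bar_letter (i, b) \<in> lists ({1..n - 1} \<times> UNIV)" if "i \<in> {1..n - 1}" for i b
    using that n by auto
  then show ?thesis using w by (fastforce simp: bar_word_def in_lists_conv_set)
qed


section \<open>Rotations of a flag system\<close>

text \<open>The adjacency maps are a parameter: \<open>r (n - 1 - j)\<close> in place of
  \<open>r j\<close> gives the rotations of the dual, and \<open>r 0 A\<close> in place of
  \<open>A\<close> those of the mirror image.\<close>

definition flag_rot :: "('g, 'm) monoid_scheme \<Rightarrow> ('g \<Rightarrow> 'f \<Rightarrow> 'f) \<Rightarrow> (nat \<Rightarrow> 'f \<Rightarrow> 'f) \<Rightarrow> 'f \<Rightarrow> nat \<Rightarrow> 'g" where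
  "flag_rot G act r A i = (THE g. g \<in> carrier G \<and> act g A = r (i - 1) (r i A))"

text \<open>\<open>r j A\<close> is \<open>A\<^sup>j\<close>, and \<open>act\<close> is a right action.\<close>

locale flag_system = group G for G :: "'a monoid" (structure) +
  fixes Fl :: "'f set" and act :: "'a \<Rightarrow> 'f \<Rightarrow> 'f" and r :: "nat \<Rightarrow> 'f \<Rightarrow> 'f" and n :: nat
  assumes act_closed: "g \<in> carrier G \<Longrightarrow> A \<in> Fl \<Longrightarrow> act g A \<in> Fl"
    and act_one: "A \<in> Fl \<Longrightarrow> act \<one> A = A"
    and act_mult: "g \<in> carrier G \<Longrightarrow> h \<in> carrier G \<Longrightarrow> A \<in> Fl \<Longrightarrow> act (g \<otimes> h) A = act h (act g A)"
    and act_free: "g \<in> carrier G \<Longrightarrow> A \<in> Fl \<Longrightarrow> act g A = A \<Longrightarrow> g = \<one>"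
    and r_closed: "A \<in> Fl \<Longrightarrow> j < n \<Longrightarrow> r j A \<in> Fl"
    and r_invol: "A \<in> Fl \<Longrightarrow> j < n \<Longrightarrow> r j (r j A) = A"
    and r_comm: "A \<in> Fl \<Longrightarrow> i + 2 \<le> j \<Longrightarrow> j < n \<Longrightarrow> r i (r j A) = r j (r i A)"
    and act_r: "g \<in> carrier G \<Longrightarrow> A \<in> Fl \<Longrightarrow> j < n \<Longrightarrow> act g (r j A) = r j (act g A)"
    and same_orbit: "A \<in> Fl \<Longrightarrow> i < n \<Longrightarrow> j < n \<Longrightarrow> \<exists>g \<in> carrier G. act g A = r j (r i A)"
begin

abbreviation rot :: "'f \<Rightarrow> nat \<Rightarrow> 'a" where "rot \<equiv> flag_rot G act r"

lemma act_inv: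
  assumes "g \<in> carrier G" "A \<in> Fl" "act g A = B"
  shows "act (inv g) B = A"
  using assms act_mult[of g "inv g" A] act_one by auto

lemma act_inj:
  assumes "g \<in> carrier G" "h \<in> carrier G" "A \<in> Fl" "act g A = act h A"
  shows "g = h"
proof -
  have "act (g \<otimes> inv h) A = A"
    using assms act_inv[of h A] by (simp add: act_mult)
  then have "g \<otimes> inv h = \<one>" using act_free assms by blast
  then show ?thesis using assms by (metis inv_equality inv_inv inv_closed)
qed

text \<open>Existence comes from \<open>same_orbit\<close>, uniqueness from freeness of the action.
  For \<open>i = 0\<close> truncated subtraction makes the target \<open>r 0 (r 0 A)\<close>, which
  is \<open>A\<close>.\<close>

lemma rot_props:
  assumes "A \<in> Fl" "i < n"
  shows "rot A i \<in> carrier G \<and> act (rot A i) A = r (i - 1) (r i A)"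
proof -
  obtain g where g: "g \<in> carrier G" "act g A = r (i - 1) (r i A)"
    using same_orbit[OF assms, of "i - 1"] assms by fastforce
  show ?thesis unfolding flag_rot_def
    by (rule theI[of _ g]) (use g assms act_inj in auto)
qed

lemmas rot_closed = rot_props[THEN conjunct1] and act_rot = rot_props[THEN conjunct2]

lemma rot_eqI:
  assumes "A \<in> Fl" "i < n" "g \<in> carrier G" "act g A = r (i - 1) (r i A)"
  shows "rot A i = g"
  using assms rot_props by (auto intro: act_inj)

lemma rot_Pi: "A \<in> Fl \<Longrightarrow> rot A \<in> {1..n - 1} \<rightarrow> carrier G"
  by (auto intro!: rot_closed)

lemma act_inv_rot:
  assumes "A \<in> Fl" "i < n"
  shows "act (inv (rot A i)) A = r i (r (i - 1) A)"
proof -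
  have "act (rot A i) (r i (r (i - 1) A)) = A"
    using assms by (simp add: act_r r_closed act_rot rot_closed r_invol act_closed)
  then show ?thesis using assms by (intro act_inv) (auto simp: rot_closed r_closed)
qed

lemma rot_act:
  assumes "A \<in> Fl" "i < n" "g \<in> carrier G"
  shows "rot (act g A) i = inv g \<otimes> rot A i \<otimes> g"
proof (rule rot_eqI)
  show "act (inv g \<otimes> rot A i \<otimes> g) (act g A) = r (i - 1) (r i (act g A))"
    using assms act_inv[of g A] by (simp add: act_mult rot_closed act_closed act_rot act_r r_closed)
qed (use assms in \<open>auto simp: act_closed rot_closed\<close>)

lemma rot_adjacent_self:
  assumes "A \<in> Fl" "i < n"
  shows "rot (r i A) i = inv (rot A i)"
  using assms by (intro rot_eqI) (auto simp: r_closed rot_closed act_r act_inv_rot r_invol)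

text \<open>The flags \<open>r i A\<close> and \<open>r j A\<close> lie in one orbit, being two
  adjacency steps apart. At \<open>r i A\<close> the rotation is inverted, and within an orbit it is
  conjugated, so the power relation survives at every adjacent flag.\<close>

lemma rot_pow_adjacent:
  assumes A: "A \<in> Fl" and i: "i < n" and j: "j < n" and p: "rot A i [^] (p::nat) = \<one>"
  shows "rot (r j A) i [^] p = \<one>"
proof -
  obtain g where g: "g \<in> carrier G" "act g (r i A) = r j (r i (r i A))"
    using same_orbit[of "r i A" i j] assms r_closed by auto
  have "rot (r j A) i = inv g \<otimes> rot (r i A) i \<otimes> g"
    using rot_act[of "r i A" i g] g A i by (simp add: r_closed r_invol)
  then have e: "rot (r j A) i = inv g \<otimes> inv (rot A i) \<otimes> g" using A i by (simp add: rot_adjacent_self)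
  interpret c: group_hom G G "\<lambda>a. inv g \<otimes> a \<otimes> g" by (rule conjugation_group_hom[OF g(1)])
  have "rot (r j A) i [^] p = inv g \<otimes> (inv (rot A i) [^] p) \<otimes> g"
    unfolding e using A i by (subst c.hom_nat_pow) (auto simp: rot_closed)
  also have "inv (rot A i) [^] p = \<one>" using p A i by (simp add: nat_pow_inv rot_closed)
  finally show ?thesis using g by simp
qed

text \<open>A telescoping product: automorphisms commute with the adjacency maps, so a further
  factor \<open>rot A (Suc j)\<close> inserts \<open>r j\<close> and \<open>r (Suc j)\<close> next
  to \<open>A\<close>, and the two copies of \<open>r j\<close> cancel.\<close>

lemma act_rot_string:
  assumes A: "A \<in> Fl" and "1 \<le> i" "i \<le> j" "j < n"
  shows "act (word_eval G (rot A) (map (\<lambda>k. (k, True)) [i..<Suc j])) A = r (i - 1) (r j A)"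
  using assms(3,4)
proof (induction j rule: dec_induct)
  case base
  then show ?case using A by (simp add: rot_closed act_rot)
next
  case (step j)
  let ?w = "map (\<lambda>k. (k, True)) [i..<Suc j]"
  have w: "?w \<in> lists ({1..n - 1} \<times> UNIV)" using step.prems assms(2) by auto arith
  have m: "map (\<lambda>k. (k, True)) [i..<Suc (Suc j)] = ?w @ [(Suc j, True)]" using step by simp
  have e: "word_eval G (rot A) (map (\<lambda>k. (k, True)) [i..<Suc (Suc j)])
      = word_eval G (rot A) ?w \<otimes> rot A (Suc j)"
    unfolding m using step A w
    by (subst word_eval_append[OF rot_Pi[OF A]]) (auto simp: rot_closed)
  have wc: "word_eval G (rot A) ?w \<in> carrier G" by (rule word_eval_closed[OF rot_Pi[OF A] w])
  have IH: "act (word_eval G (rot A) ?w) A = r (i - 1) (r j A)" using step by simp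
  show ?case unfolding e act_mult[OF wc rot_closed[OF A step.prems] A] IH
    using step A by (simp add: act_r r_closed rot_closed act_rot r_invol)
qed

text \<open>The product of the string is determined by the two adjacency maps
  \<open>r (i - 1)\<close> and \<open>r j\<close>. Their indices differ by at least two because
  \<open>i < j\<close>, so they commute, the square fixes \<open>A\<close>, and freeness
  applies.\<close>

lemma word_eval_string_relator:
  assumes A: "A \<in> Fl" and w: "w \<in> string_relators n"
  shows "word_eval G (rot A) w = \<one>"
proof -
  obtain i j where ij: "1 \<le> i" "i < j" "j \<le> n - 1"
    and w: "w = concat (replicate 2 (map (\<lambda>k. (k, True)) [i..<Suc j]))"
    using w by (auto simp: string_relators_def)
  let ?u = "map (\<lambda>k. (k, True)) [i..<Suc j]"
  have jn: "j < n" using ij by auto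
  have u: "?u \<in> lists ({1..n - 1} \<times> UNIV)" using ij by auto
  have uc: "word_eval G (rot A) ?u \<in> carrier G" by (rule word_eval_closed[OF rot_Pi[OF A] u])
  have a: "act (word_eval G (rot A) ?u) A = r (i - 1) (r j A)"
    using ij jn A by (intro act_rot_string) auto
  have "w = ?u @ ?u" using w by (simp add: numeral_2_eq_2)
  then have e: "word_eval G (rot A) w = word_eval G (rot A) ?u \<otimes> word_eval G (rot A) ?u"
    using word_eval_append[OF rot_Pi[OF A] u u] by simp
  have c: "r (i - 1) (r j B) = r j (r (i - 1) B)" if "B \<in> Fl" for B
    using that ij jn by (intro r_comm) auto
  have "act (word_eval G (rot A) ?u \<otimes> word_eval G (rot A) ?u) A
      = r (i - 1) (r j (r (i - 1) (r j A)))"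
    using A uc a ij jn by (simp add: act_mult act_r r_closed)
  also have "r j (r (i - 1) (r j A)) = r (i - 1) A"
    using A ij jn by (subst c) (simp_all add: r_invol r_closed)
  also have "r (i - 1) (r (i - 1) A) = A" using A ij jn by (intro r_invol) auto
  finally show ?thesis unfolding e using act_free uc A by blast
qed

text \<open>Assuming a power relation, rather than that \<open>p i\<close> is the order at
  \<open>A\<close>, lets the same exponents serve the mirror flag; it also covers infinite entries,
  where \<open>p i = 0\<close>.\<close>

lemma word_eval_coxeter_relator:
  assumes A: "A \<in> Fl" and p: "\<And>i. i \<in> {1..n - 1} \<Longrightarrow> rot A i [^] p i = \<one>"
    and w: "w \<in> coxeter_rot_relators n p"
  shows "word_eval G (rot A) w = \<one>"
proof -
  consider i where "i \<in> {1..n - 1}" "w = replicate (p i) (i, True)" | "w \<in> string_relators n"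
    using w by (auto simp: coxeter_rot_relators_def)
  then show ?thesis
  proof cases
    case 1
    have "rot A i \<in> carrier G" using A 1(1) by (intro rot_closed) auto
    then show ?thesis using 1 p by (simp only: word_eval_replicate)
  qed (use A word_eval_string_relator in auto)
qed

text \<open>This is where the formula for the bar operation comes from. For \<open>i \<ge> 3\<close>
  the map \<open>r 0\<close> commutes with both maps defining the rotation. For \<open>i = 2\<close>
  it fails to commute with \<open>r 1\<close>, which costs the two factors \<open>rot A 1\<close>;
  for \<open>i = 1\<close> it is itself one of the two maps.\<close>

lemma rot_mirror:
  assumes A: "A \<in> Fl" and i: "i \<in> {1..n - 1}"
  shows "rot (r 0 A) i = word_eval G (rot A) (bar_letter (i, True))"
proof -
  have lt: "0 < n" "1 < n" "i < n" using i by auto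
  consider "i = 1" | "i = 2" | "3 \<le> i" using i by fastforce
  then show ?thesis
  proof cases
    case 1
    have "rot (r 0 A) i = inv (rot A i)"
      using 1 lt A by (intro rot_eqI) (auto simp: r_closed rot_closed act_r act_inv_rot)
    then show ?thesis using 1 A lt by (simp add: rot_closed)
  next
    case 2
    have c: "r 0 (r 2 A) = r 2 (r 0 A)" using 2 A lt by (intro r_comm) auto
    have "rot (r 0 A) i = rot A 1 \<otimes> (rot A 1 \<otimes> rot A 2)"
      using 2 lt A
      by (intro rot_eqI) (simp_all add: r_closed rot_closed act_closed act_r act_mult act_rot r_invol c)
    then show ?thesis using 2 A lt by (simp add: rot_closed)
  next
    case 3
    have c: "r 0 (r (i - 1) (r i A)) = r (i - 1) (r i (r 0 A))"
    proof -
      have "r 0 (r (i - 1) (r i A)) = r (i - 1) (r 0 (r i A))"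
        using 3 A lt by (intro r_comm) (auto simp: r_closed)
      also have "r 0 (r i A) = r i (r 0 A)" using 3 A lt by (intro r_comm) auto
      finally show ?thesis .
    qed
    have "rot (r 0 A) i = rot A i"
      using 3 lt A by (intro rot_eqI) (simp_all add: r_closed rot_closed act_r act_rot c[simplified])
    then show ?thesis using 3 A lt by (simp add: rot_closed)
  qed
qed

lemma word_eval_bar_word:
  assumes A: "A \<in> Fl" and n: "2 \<le> n" and w: "w \<in> lists ({1..n - 1} \<times> UNIV)"
  shows "word_eval G (rot A) (bar_word w) = word_eval G (rot (r 0 A)) w"
  unfolding bar_word_def
proof (rule word_eval_subst[OF rot_Pi[OF A] _ _ w])
  fix i b assume i: "i \<in> {1..n - 1}"
  show "bar_letter (i, b) \<in> lists ({1..n - 1} \<times> UNIV)" using i n by auto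
  have T: "bar_letter (i, True) \<in> lists ({1..n - 1} \<times> UNIV)" using i n by auto
  have "bar_letter (i, False) = rev (map (apsnd Not) (bar_letter (i, True)))" by auto
  then have "word_eval G (rot A) (bar_letter (i, False)) = inv (word_eval G (rot A) (bar_letter (i, True)))"
    using word_eval_inverse[OF rot_Pi[OF A] T] by simp
  then show "word_eval G (rot A) (bar_letter (i, b)) = (if b then rot (r 0 A) i else inv (rot (r 0 A) i))"
    unfolding rot_mirror[OF A i] by (cases b) simp_all
qed

text \<open>The assumptions are symmetric under reversal of the indices, so every fact about
  rotations also holds for those of the dual.\<close>

lemma dual_flag_system: "flag_system G Fl act (\<lambda>j. r (n - 1 - j)) n"
proof unfold_locales
  show "r (n - 1 - i) (r (n - 1 - j) A) = r (n - 1 - j) (r (n - 1 - i) A)"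
    if "A \<in> Fl" "i + 2 \<le> j" "j < n" for A i j
    using r_comm[of A "n - 1 - j" "n - 1 - i"] that by auto
  show "\<exists>g\<in>carrier G. act g A = r (n - 1 - j) (r (n - 1 - i) A)"
    if "A \<in> Fl" "i < n" "j < n" for A i j
    using that by (intro same_orbit) auto
qed (auto simp: act_closed act_one act_mult r_closed r_invol act_r intro: act_free)

text \<open>Reversing the indices turns the pair \<open>i\<close>, \<open>i - 1\<close> into
  \<open>n - i - 1\<close>, \<open>n - i\<close>: the two adjacency maps of
  \<open>rot A (n - i)\<close> in the opposite order.\<close>

lemma rot_dual:
  assumes "A \<in> Fl" "i \<in> {1..n - 1}"
  shows "flag_rot G act (\<lambda>j. r (n - 1 - j)) A i = inv (rot A (n - i))"
proof -
  interpret d: flag_system G Fl act "\<lambda>j. r (n - 1 - j)" n by (rule dual_flag_system)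
  have [simp]: "n - 1 - (i - 1) = n - i" "n - 1 - i = n - i - 1" using assms by auto
  show ?thesis using assms
    by (intro d.rot_eqI) (auto simp: rot_closed act_inv_rot)
qed

end

section \<open>The counting bound for a bar-invariant kernel\<close>

context flag_system
begin

text \<open>If the kernel of \<open>w \<mapsto> (w(x), w(y))\<close> is invariant under the bar operation, then the joint image
  in \<open>\<Gamma>\<^sup>4\<close> under \<open>(x, xb, y, yb)\<close> has order at most \<open>|\<Gamma>|\<^sup>2\<close>.\<close>

lemma card_mix_mirror_bound:
  fixes p :: "nat \<Rightarrow> nat"
  defines "I \<equiv> {1..n - 1}"
    and "r' \<equiv> \<lambda>j. r (n - 1 - j)"
  assumes n: "2 \<le> n" and fin: "finite (carrier G)" and A: "A \<in> Fl"
    and p: "\<And>i. i \<in> I \<Longrightarrow> rot A i [^] p i = \<one>"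
    and finC: "finite (carrier (comix I (coxeter_rot_relators n p) (coxeter_rot_relators n (\<lambda>i. p (n - i)))))"
    and bar: "\<And>w. w \<in> lists (I \<times> UNIV) \<Longrightarrow> word_eval G (rot A) w = \<one> \<Longrightarrow>
      word_eval G (flag_rot G act r' A) w = \<one> \<Longrightarrow>
      word_eval G (rot A) (bar_word w) = \<one> \<and> word_eval G (flag_rot G act r' A) (bar_word w) = \<one>"
  shows "(card (carrier (mix I G (rot A) G (rot (r 0 A)))))\<^sup>2
    \<le> (card (carrier G))\<^sup>2 *
      card (carrier (comix I (coxeter_rot_relators n p) (coxeter_rot_relators n (\<lambda>i. p (n - i)))))"
proof -
  interpret d: flag_system G Fl act r' n unfolding r'_def by (rule dual_flag_system)
  let ?W = "lists (I \<times> (UNIV :: bool set))"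
  let ?C = "carrier (comix I (coxeter_rot_relators n p) (coxeter_rot_relators n (\<lambda>i. p (n - i))))"
  define x xb y yb where "x = rot A" and "xb = rot (r 0 A)" and "y = d.rot A" and "yb = d.rot (r' 0 A)"
  have B: "r 0 A \<in> Fl" "r' 0 A \<in> Fl" using A n by (auto simp: r_closed d.r_closed)
  have Pi: "x \<in> I \<rightarrow> carrier G" "xb \<in> I \<rightarrow> carrier G" "y \<in> I \<rightarrow> carrier G" "yb \<in> I \<rightarrow> carrier G"
    using rot_Pi[OF A] rot_Pi[OF B(1)] d.rot_Pi[OF A] d.rot_Pi[OF B(2)]
    unfolding x_def xb_def y_def yb_def I_def by simp_all
  note K = word_eval_mix[OF is_group is_group Pi(1,2)]
  note L = word_eval_mix[OF is_group is_group Pi(3,4)]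
  let ?K = "mix I G x G xb" and ?L = "mix I G y G yb"
  let ?k = "\<lambda>i. (x i, xb i)" and ?l = "\<lambda>i. (y i, yb i)"
  have barx: "word_eval G x (bar_word w) = word_eval G xb w"
    and bary: "word_eval G y (bar_word w) = word_eval G yb w" if "w \<in> ?W" for w
    using that A n unfolding x_def xb_def y_def yb_def I_def
    by (simp_all add: word_eval_bar_word d.word_eval_bar_word)
  have px: "x i [^] p i = \<one>" "xb i [^] p i = \<one>" if "i \<in> I" for i
    using p[OF that] rot_pow_adjacent[OF A, of i 0 "p i"] that n unfolding x_def xb_def I_def by auto
  have py: "y i [^] p (n - i) = \<one>" if "i \<in> I" for i
  proof -
    have ni: "n - i \<in> I" using that by (auto simp: I_def)
    have "y i = inv (x (n - i))" unfolding y_def x_def r'_def using rot_dual[OF A] that I_def by simp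
    then show ?thesis using px(1)[OF ni] Pi(1) ni by (auto simp: nat_pow_inv Pi_iff)
  qed
  have pyb: "yb i [^] p (n - i) = \<one>" if "i \<in> I" for i
    using py[OF that] d.rot_pow_adjacent[OF A, of i 0 "p (n - i)"] that n unfolding y_def yb_def I_def by auto
  have fK: "finite (carrier ?K)"
    by (rule finite_subset[of _ "carrier G \<times> carrier G"])
      (use fin word_eval_closed[OF Pi(1)] word_eval_closed[OF Pi(2)] in \<open>auto simp: K(4) simp del: in_lists_conv_set\<close>)
  have fL: "finite (carrier ?L)"
    by (rule finite_subset[of _ "carrier G \<times> carrier G"])
      (use fin word_eval_closed[OF Pi(3)] word_eval_closed[OF Pi(4)] in \<open>auto simp: L(4) simp del: in_lists_conv_set\<close>)
  have Kc: "carrier ?K = word_eval ?K ?k ` ?W"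
    unfolding K(4) by (rule image_cong[OF HOL.refl]) (simp only: K(3))
  have Lc: "carrier ?L = word_eval ?L ?l ` ?W"
    unfolding L(4) by (rule image_cong[OF HOL.refl]) (simp only: L(3))
  let ?Q = "(\<lambda>w. (word_eval ?K ?k w, word_eval ?L ?l w)) ` ?W"
  \<comment> \<open>Both coordinates of \<open>?K\<close> satisfy the relators of the type, and both
    coordinates of \<open>?L\<close> those of the reversed type, so the Goursat count applies with
    exactly the comix of the hypothesis.\<close>
  have 1: "card (carrier ?K) * card (carrier ?L) \<le> card ?Q * card ?C"
  proof (rule card_mult_le_joint_image_times_comix[OF K(1) fK K(2) Kc L(1) fL L(2) Lc _ _ finC])
    fix w assume w: "w \<in> ?W"
    show "word_eval ?K ?k w = \<one>\<^bsub>?K\<^esub>" if "w \<in> coxeter_rot_relators n p"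
      unfolding K(3)[OF w] K(5)
      using word_eval_coxeter_relator[OF A _ that] word_eval_coxeter_relator[OF B(1) _ that] px
      unfolding x_def xb_def I_def by blast
    show "word_eval ?L ?l w = \<one>\<^bsub>?L\<^esub>" if "w \<in> coxeter_rot_relators n (\<lambda>i. p (n - i))"
      unfolding L(3)[OF w] L(5)
      using d.word_eval_coxeter_relator[OF A _ that] d.word_eval_coxeter_relator[OF B(2) _ that] py pyb
      unfolding y_def yb_def I_def by blast
  qed
  have bar': "word_eval G xb w = \<one> \<and> word_eval G yb w = \<one>"
    if "w \<in> ?W" "word_eval G x w = \<one>" "word_eval G y w = \<one>" for w
    using bar[OF that(1)] that(2,3) barx[OF that(1)] bary[OF that(1)] unfolding x_def y_def by simp
  \<comment> \<open>Apply the statement about kernels to \<open>u\<close> followed by the formal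
    inverse of \<open>v\<close>.\<close>
  have inj: "word_eval G xb u = word_eval G xb v \<and> word_eval G yb u = word_eval G yb v"
    if u: "u \<in> ?W" and v: "v \<in> ?W" and xe: "word_eval G x u = word_eval G x v"
      and ye: "word_eval G y u = word_eval G y v" for u v
  proof -
    let ?v = "rev (map (apsnd Not) v)"
    have v': "?v \<in> ?W" using v by (auto simp: in_lists_conv_set)
    have uv: "u @ ?v \<in> ?W" using u v' by simp
    have e: "word_eval G z (u @ ?v) = word_eval G z u \<otimes> inv (word_eval G z v)"
      if "z \<in> I \<rightarrow> carrier G" for z
      using word_eval_append[OF that u v'] word_eval_inverse[OF that v] by simp
    have c: "word_eval G z w \<in> carrier G" if "z \<in> I \<rightarrow> carrier G" "w \<in> ?W" for z w
      by (rule word_eval_closed[OF that])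
    have "word_eval G xb (u @ ?v) = \<one> \<and> word_eval G yb (u @ ?v) = \<one>"
      by (rule bar'[OF uv]) (use e[OF Pi(1)] e[OF Pi(3)] xe ye c[OF Pi(1) v] c[OF Pi(3) v] in simp_all)
    then show ?thesis
      using e[OF Pi(2)] e[OF Pi(4)] c[OF Pi(2) u] c[OF Pi(4) u] c[OF Pi(2) v] c[OF Pi(4) v]
      by (metis inv_equality inv_closed inv_inv)
  qed
  \<comment> \<open>By \<open>inj\<close> the values at \<open>x\<close> and \<open>y\<close>
    determine those at \<open>xb\<close> and \<open>yb\<close>, so forgetting the latter is
    injective on \<open>?Q\<close>. The nested \<open>case\<close> expressions below are this
    projection written out.\<close>
  have "card ?Q \<le> card (carrier G \<times> carrier G)"
  proof (rule card_inj_on_le[where f = "\<lambda>((a, b), (c, e)). (a, c)"])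
    show "inj_on (\<lambda>((a, b), (c, e)). (a, c)) ?Q"
    proof (rule inj_onI)
      fix s t assume "s \<in> ?Q" "t \<in> ?Q"
        and eq: "(case s of (a, b) \<Rightarrow> (case a of (a, b) \<Rightarrow> \<lambda>(c, e). (a, c)) b)
          = (case t of (a, b) \<Rightarrow> (case a of (a, b) \<Rightarrow> \<lambda>(c, e). (a, c)) b)"
      then obtain u v where uv: "u \<in> ?W" "v \<in> ?W"
        and st: "s = (word_eval ?K ?k u, word_eval ?L ?l u)" "t = (word_eval ?K ?k v, word_eval ?L ?l v)"
        by (elim imageE) (rule that)
      show "s = t" using eq inj[OF uv] unfolding st K(3)[OF uv(1)] K(3)[OF uv(2)] L(3)[OF uv(1)] L(3)[OF uv(2)]
        by simp
    qed
    show "(\<lambda>((a, b), (c, e)). (a, c)) ` ?Q \<subseteq> carrier G \<times> carrier G"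
    proof (rule image_subsetI, elim imageE)
      fix s w assume w: "w \<in> ?W" and s: "s = (word_eval ?K ?k w, word_eval ?L ?l w)"
      show "(case s of (a, b) \<Rightarrow> (case a of (a, b) \<Rightarrow> \<lambda>(c, e). (a, c)) b) \<in> carrier G \<times> carrier G"
        unfolding s K(3)[OF w] L(3)[OF w]
        using word_eval_closed[OF Pi(1) w] word_eval_closed[OF Pi(3) w] by simp
    qed
    show "finite (carrier G \<times> carrier G)" using fin by simp
  qed
  then have 2: "card ?Q \<le> (card (carrier G))\<^sup>2" by (simp add: card_cartesian_product power2_eq_square)
  \<comment> \<open>Conjugation carries the rotations at \<open>A\<^sup>0\<close> to those at \<open>A\<^bsup>n-1\<^esup>\<close>, which are inverse to the dual ones.\<close>
  obtain g where g: "g \<in> carrier G" "act g (r 0 A) = r (n - 1) (r 0 (r 0 A))"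
    using same_orbit[OF B(1), of 0 "n - 1"] n by auto
  then have g2: "act g (r 0 A) = r (n - 1) A" using A n by (simp add: r_invol)
  define xc where "xc i = inv g \<otimes> xb i \<otimes> g" for i
  interpret c: group_hom G G "\<lambda>a. inv g \<otimes> a \<otimes> g" by (rule conjugation_group_hom[OF g(1)])
  have xc: "xc i = rot (r (n - 1) A) i" if "i \<in> I" for i
    using rot_act[OF B(1) _ g(1), of i] that unfolding g2 xc_def xb_def I_def by auto
  have xcPi: "xc \<in> I \<rightarrow> carrier G" using Pi(2) g by (auto simp: xc_def Pi_iff)
  have dI: "n - i \<in> I" "n - (n - i) = i" if "i \<in> I" for i using that by (auto simp: I_def)
  have y: "y (n - i) = inv (x i)" if "i \<in> I" for i
    using rot_dual[OF A, of "n - i"] dI[OF that] unfolding y_def x_def r'_def I_def by simp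
  have Bn: "r (n - 1) A \<in> Fl" using A n by (simp add: r_closed)
  have yb: "yb (n - i) = inv (xc i)" if "i \<in> I" for i
    using rot_dual[OF Bn, of "n - i"] dI[OF that] xc[OF that] unfolding yb_def r'_def I_def by simp
  \<comment> \<open>Conjugating the second coordinate by \<open>g\<close> and then translating each
    letter to the inverse letter of reversed index sends pairs of values at \<open>x\<close>,
    \<open>xb\<close> to pairs of values at \<open>y\<close>, \<open>yb\<close>.\<close>
  have "card (carrier ?K) \<le> card (carrier ?L)"
  proof (rule card_inj_on_le[where f = "\<lambda>(a, b). (a, inv g \<otimes> b \<otimes> g)", OF _ _ fL])
    show "inj_on (\<lambda>(a, b). (a, inv g \<otimes> b \<otimes> g)) (carrier ?K)"
    proof (rule inj_onI, clarify)
      fix a b c d assume ab: "(a, b) \<in> carrier ?K" "(c, d) \<in> carrier ?K"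
        and e: "inv g \<otimes> b \<otimes> g = inv g \<otimes> d \<otimes> g"
      have "b \<in> carrier G" "d \<in> carrier G" using ab word_eval_closed[OF Pi(2)] unfolding K(4) by blast+
      then show "a = a \<and> b = d" using e g by simp
    qed
    show "(\<lambda>(a, b). (a, inv g \<otimes> b \<otimes> g)) ` carrier ?K \<subseteq> carrier ?L"
      unfolding K(4) L(4)
    proof (rule image_subsetI, elim imageE)
      fix s w assume w: "w \<in> ?W" and s: "s = (word_eval G x w, word_eval G xb w)"
      let ?w = "map (\<lambda>(i, b). (n - i, \<not> b)) w"
      have w': "?w \<in> ?W" using w dI by (fastforce simp: in_lists_conv_set)
      have "inv g \<otimes> word_eval G xb w \<otimes> g = word_eval G xc w"
        using word_eval_hom[OF c.group_hom_axioms Pi(2) w] by (simp add: comp_def xc_def[abs_def])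
      then have "(case s of (a, b) \<Rightarrow> (a, inv g \<otimes> b \<otimes> g)) = (word_eval G y ?w, word_eval G yb ?w)"
        unfolding s using word_eval_reverse_invert[where f = "\<lambda>i. n - i", OF y Pi(1) w] word_eval_reverse_invert[where f = "\<lambda>i. n - i", OF yb xcPi w] by simp
      then show "(case s of (a, b) \<Rightarrow> (a, inv g \<otimes> b \<otimes> g)) \<in> (\<lambda>w. (word_eval G y w, word_eval G yb w)) ` ?W"
        using w' by (rule image_eqI)
    qed
  qed
  then have "(card (carrier ?K))\<^sup>2 \<le> card (carrier ?K) * card (carrier ?L)"
    by (simp add: power2_eq_square)
  also note 1
  also have "card ?Q * card ?C \<le> (card (carrier G))\<^sup>2 * card ?C" using 2 by (rule mult_le_mono1)
  finally show ?thesis unfolding x_def xb_def .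
qed

end

section \<open>Flags of an abstract polytope\<close>

lemma card_2_other_unique:
  "card S = 2 \<Longrightarrow> c \<in> S \<Longrightarrow> a \<in> S \<Longrightarrow> b \<in> S \<Longrightarrow> a \<noteq> c \<Longrightarrow> b \<noteq> c \<Longrightarrow> a = b"
  by (auto simp: card_2_iff)

locale polytope =
  fixes n :: nat and P :: "'a based_poset"
  assumes abstract_polytope: "abstract_polytope n P"
begin

lemma ranked: "ranked_poset n P"
  and flag_card: "A \<in> flags P \<Longrightarrow> card A = n + 2"
  and diamond: "diamond_condition P"
  and connected: "strongly_flag_connected P"
  and base_flag: "base P \<in> flags P"
  using abstract_polytope by (auto simp: abstract_polytope_def)

lemma order: "Partial_order (le P)"
  and rk_bounds: "F \<in> faces P \<Longrightarrow> -1 \<le> rk P F \<and> rk P F \<le> int n"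
  and lt_rk: "lt P F G \<Longrightarrow> rk P F < rk P G"
  using ranked by (auto simp: ranked_poset_def)

lemma le_trans: "(F, G) \<in> le P \<Longrightarrow> (G, H) \<in> le P \<Longrightarrow> (F, H) \<in> le P"
  using order by (auto simp: partial_order_on_def preorder_on_def elim: transE)

lemma le_refl: "F \<in> faces P \<Longrightarrow> (F, F) \<in> le P"
  using order by (auto simp: partial_order_on_def preorder_on_def refl_on_def faces_def)

lemma chain_faces: "C \<in> Chains (le P) \<Longrightarrow> C \<subseteq> faces P"
  by (auto simp: Chains_def faces_def Field_def)

lemma chain_lt_or: "C \<in> Chains (le P) \<Longrightarrow> F \<in> C \<Longrightarrow> G \<in> C \<Longrightarrow> F = G \<or> lt P F G \<or> lt P G F"
  by (auto simp: Chains_def lt_def)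

lemma chain_rk_inj: "C \<in> Chains (le P) \<Longrightarrow> inj_on (rk P) C"
  by (rule inj_onI) (metis chain_lt_or less_irrefl lt_rk)

lemma chain_rk_image: "C \<in> Chains (le P) \<Longrightarrow> rk P ` C \<subseteq> {-1..int n}"
  using chain_faces rk_bounds by fastforce

lemma chain_finite_card: "C \<in> Chains (le P) \<Longrightarrow> finite C \<and> card C \<le> n + 2"
proof -
  assume C: "C \<in> Chains (le P)"
  have "card C \<le> card {-1..int n}"
    by (rule card_inj_on_le[OF chain_rk_inj[OF C] chain_rk_image[OF C]]) simp
  moreover have "finite C"
    by (rule inj_on_finite[OF chain_rk_inj[OF C] chain_rk_image[OF C]]) simp
  ultimately show ?thesis by simp
qed

text \<open>Ranks are injective on a chain and take at most \<open>n + 2\<close> values, so a chain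
  with that many faces cannot be extended. Maximality thus becomes a count.\<close>

lemma flags_iff: "A \<in> flags P \<longleftrightarrow> A \<in> Chains (le P) \<and> card A = n + 2"
proof
  show "A \<in> Chains (le P) \<and> card A = n + 2" if "A \<in> flags P"
    using that flag_card by (auto simp: flags_def)
  show "A \<in> flags P" if A: "A \<in> Chains (le P) \<and> card A = n + 2"
    unfolding flags_def
  proof (intro CollectI conjI ballI impI)
    fix D assume D: "D \<in> Chains (le P)" "A \<subseteq> D"
    then have "A = D" using A chain_finite_card[OF D(1)] by (intro card_seteq) auto
    then show "D = A" ..
  qed (use A in simp)
qed

lemma flag_chain: "A \<in> flags P \<Longrightarrow> A \<in> Chains (le P)" by (simp add: flags_iff)

lemma flag_faces: "A \<in> flags P \<Longrightarrow> A \<subseteq> faces P" using chain_faces flag_chain by blast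

lemma flag_rk_bij: "A \<in> flags P \<Longrightarrow> bij_betw (rk P) A {-1..int n}"
proof -
  assume A: "A \<in> flags P"
  have "card (rk P ` A) = n + 2" using A chain_rk_inj[OF flag_chain] card_image flag_card by metis
  then have "rk P ` A = {-1..int n}"
    using chain_rk_image[OF flag_chain[OF A]] by (intro card_subset_eq) auto
  then show ?thesis using chain_rk_inj[OF flag_chain[OF A]] by (simp add: bij_betw_def)
qed

definition face_at :: "'a set \<Rightarrow> int \<Rightarrow> 'a" where
  "face_at A k = (THE F. F \<in> A \<and> rk P F = k)"

lemma face_at_rk: "A \<in> flags P \<Longrightarrow> F \<in> A \<Longrightarrow> face_at A (rk P F) = F"
  unfolding face_at_def using chain_rk_inj[OF flag_chain] by (auto dest: inj_onD)

lemma face_at_props: "A \<in> flags P \<Longrightarrow> -1 \<le> k \<Longrightarrow> k \<le> int n \<Longrightarrow> face_at A k \<in> A \<and> rk P (face_at A k) = k"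
proof -
  assume A: "A \<in> flags P" and k: "-1 \<le> k" "k \<le> int n"
  then have "k \<in> rk P ` A" using flag_rk_bij[OF A] by (auto simp: bij_betw_def)
  then obtain F where "F \<in> A" "rk P F = k" by auto
  then show ?thesis using face_at_rk[OF A] by auto
qed

lemma flag_eqI:
  assumes "A \<in> flags P" "B \<in> flags P" "\<And>k. -1 \<le> k \<Longrightarrow> k \<le> int n \<Longrightarrow> face_at A k = face_at B k"
  shows "A = B"
proof -
  have "C = face_at C ` {-1..int n}" if C: "C \<in> flags P" for C
  proof
    show "C \<subseteq> face_at C ` {-1..int n}"
    proof
      fix F assume F: "F \<in> C"
      then have "rk P F \<in> {-1..int n}" using flag_faces[OF C] rk_bounds by auto
      then show "F \<in> face_at C ` {-1..int n}" using face_at_rk[OF C F] by (metis image_eqI)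
    qed
    show "face_at C ` {-1..int n} \<subseteq> C" using face_at_props[OF C] by auto
  qed
  moreover have "face_at A ` {-1..int n} = face_at B ` {-1..int n}"
    using assms(3) by (intro image_cong) auto
  ultimately show ?thesis using assms(1,2) by metis
qed

lemma flag_rk_lt:
  assumes "A \<in> flags P" "F \<in> A" "G \<in> A" "rk P F < rk P G"
  shows "lt P F G"
  using chain_lt_or[OF flag_chain[OF assms(1)] assms(2,3)] assms(4) lt_rk[of G F] by auto

section \<open>The diamond condition and adjacent flags\<close>

definition between :: "'a \<Rightarrow> 'a \<Rightarrow> 'a set" where
  "between F G = {H. lt P F H \<and> lt P H G \<and> rk P H = rk P F + 1}"

lemma face_at_between:
  assumes "A \<in> flags P" "0 \<le> j" "j < int n"
  shows "face_at A j \<in> between (face_at A (j - 1)) (face_at A (j + 1))"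
proof -
  have p: "face_at A (j - 1) \<in> A" "rk P (face_at A (j - 1)) = j - 1" "face_at A j \<in> A"
    "rk P (face_at A j) = j" "face_at A (j + 1) \<in> A" "rk P (face_at A (j + 1)) = j + 1"
    using face_at_props[OF assms(1)] assms(2,3) by simp_all
  then show ?thesis by (simp add: between_def flag_rk_lt[OF assms(1)])
qed

lemma card_between:
  assumes "A \<in> flags P" "0 \<le> j" "j < int n"
  shows "card (between (face_at A (j - 1)) (face_at A (j + 1))) = 2"
proof -
  have p: "face_at A (j - 1) \<in> A" "rk P (face_at A (j - 1)) = j - 1"
    "face_at A (j + 1) \<in> A" "rk P (face_at A (j + 1)) = j + 1"
    using face_at_props[OF assms(1)] assms(2,3) by simp_all
  then have "lt P (face_at A (j - 1)) (face_at A (j + 1))" by (simp add: flag_rk_lt[OF assms(1)])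
  moreover have "rk P (face_at A (j + 1)) = rk P (face_at A (j - 1)) + 2" using p by simp
  ultimately show ?thesis using diamond unfolding diamond_condition_def between_def by blast
qed

definition agree_off :: "int \<Rightarrow> 'a set \<Rightarrow> 'a set \<Rightarrow> bool" where
  "agree_off j B A \<longleftrightarrow> {F \<in> B. rk P F \<noteq> j} = {F \<in> A. rk P F \<noteq> j}"

lemma agree_off_iff: "agree_off j B A \<longleftrightarrow> (\<forall>F. rk P F \<noteq> j \<longrightarrow> (F \<in> B \<longleftrightarrow> F \<in> A))"
  by (auto simp: agree_off_def set_eq_iff)

lemma agree_off_face_at:
  assumes "A \<in> flags P" "B \<in> flags P" "agree_off j B A" "-1 \<le> k" "k \<le> int n" "k \<noteq> j"
  shows "face_at B k = face_at A k"
proof -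
  have "face_at A k \<in> B" "rk P (face_at A k) = k"
    using face_at_props[OF assms(1,4,5)] assms(3,6) by (simp_all add: agree_off_iff)
  then show ?thesis using face_at_rk[OF assms(2), of "face_at A k"] by simp
qed

lemma agree_off_neq:
  assumes "A \<in> flags P" "B \<in> flags P" "agree_off j B A" "B \<noteq> A"
  shows "face_at B j \<noteq> face_at A j"
proof
  assume e: "face_at B j = face_at A j"
  have "A = B"
    by (rule flag_eqI[OF assms(1,2)]) (metis e agree_off_face_at[OF assms(1-3)])
  then show False using assms(4) by simp
qed

lemma agree_off_face_at_self:
  assumes A: "A \<in> flags P" and B: "B \<in> flags P" and a: "agree_off j B A" and j: "0 \<le> j" "j < int n"
  shows "face_at B j \<in> between (face_at A (j - 1)) (face_at A (j + 1))"
  using face_at_between[OF B j] agree_off_face_at[OF A B a, of "j - 1"]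
    agree_off_face_at[OF A B a, of "j + 1"] j by simp

text \<open>The diamond condition supplies a second face \<open>H'\<close> between the neighbours of
  the \<open>j\<close>-face \<open>H\<close>. Exchanging the two keeps a chain, because every other
  face of \<open>A\<close> is one of these neighbours or lies beyond one of them.\<close>

lemma adj_flag_ex:
  assumes A: "A \<in> flags P" and j: "0 \<le> j" "j < int n"
  shows "\<exists>B. B \<in> flags P \<and> B \<noteq> A \<and> agree_off j B A"
proof -
  define F G H where "F = face_at A (j - 1)" and "G = face_at A (j + 1)" and "H = face_at A j"
  have F: "F \<in> A" "rk P F = j - 1" and G: "G \<in> A" "rk P G = j + 1" and H: "H \<in> A" "rk P H = j"
    using face_at_props[OF A] j unfolding F_def G_def H_def by auto
  have "card (between F G) = 2" "H \<in> between F G"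
    using card_between[OF A j] face_at_between[OF A j] unfolding F_def G_def H_def by auto
  then obtain H' where H': "H' \<in> between F G" "H' \<noteq> H" by (auto simp: card_2_iff)
  have rH': "rk P H' = j" and lts: "lt P F H'" "lt P H' G" using H' F by (auto simp: between_def)
  have nH': "H' \<notin> A" using face_at_rk[OF A, of H'] rH' H' unfolding H_def by auto
  define B where "B = insert H' (A - {H})"
  have le: "(K, H') \<in> le P \<or> (H', K) \<in> le P" if K: "K \<in> A - {H}" for K
  proof -
    have "rk P K \<noteq> j" using K face_at_rk[OF A, of K] unfolding H_def by auto
    then consider "rk P K < rk P F" | "rk P K = rk P F" | "rk P K = rk P G" | "rk P K > rk P G"
      using F G by force
    then show ?thesis
    proof cases
      case 1
      then show ?thesis using flag_rk_lt[OF A _ F(1)] K lts le_trans by (auto simp: lt_def)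
    next
      case 2
      then have "K = F" using face_at_rk[OF A] K F by (metis DiffD1)
      then show ?thesis using lts by (auto simp: lt_def)
    next
      case 3
      then have "K = G" using face_at_rk[OF A] K G by (metis DiffD1)
      then show ?thesis using lts by (auto simp: lt_def)
    next
      case 4
      then show ?thesis using flag_rk_lt[OF A G(1)] K lts le_trans by (auto simp: lt_def)
    qed
  qed
  have "H' \<in> faces P" using lts by (auto simp: lt_def faces_def Field_def)
  then have "B \<in> Chains (le P)"
    using le flag_chain[OF A] le_refl unfolding B_def Chains_def by auto
  moreover have "card B = n + 2"
    using nH' H flag_card[OF A] chain_finite_card[OF flag_chain[OF A]] by (simp add: B_def)
  ultimately have "B \<in> flags P" by (simp add: flags_iff)
  moreover have "B \<noteq> A" using nH' by (auto simp: B_def)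
  moreover have "agree_off j B A" using rH' H by (auto simp: B_def agree_off_iff)
  ultimately show ?thesis by blast
qed

lemma adj_flag_unique:
  assumes A: "A \<in> flags P" and j: "0 \<le> j" "j < int n"
    and B: "B \<in> flags P" "B \<noteq> A" "agree_off j B A"
    and C: "C \<in> flags P" "C \<noteq> A" "agree_off j C A"
  shows "B = C"
proof (rule flag_eqI[OF B(1) C(1)])
  fix k assume k: "-1 \<le> k" "k \<le> int n"
  show "face_at B k = face_at C k"
  proof (cases "k = j")
    case True
    have "face_at B j = face_at C j"
      by (rule card_2_other_unique[OF card_between[OF A j] face_at_between[OF A j]])
        (intro agree_off_face_at_self[OF A _ _ j] agree_off_neq[OF A] B C)+
    then show ?thesis using True by simp
  qed (use agree_off_face_at[OF A B(1,3) k] agree_off_face_at[OF A C(1,3) k] in simp)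
qed

lemma adj_flag_props:
  assumes A: "A \<in> flags P" and j: "0 \<le> j" "j < int n"
  shows "adj_flag P A j \<in> flags P \<and> adj_flag P A j \<noteq> A \<and> agree_off j (adj_flag P A j) A"
proof -
  have "\<exists>!B. B \<in> flags P \<and> B \<noteq> A \<and> agree_off j B A"
    using adj_flag_ex[OF assms] adj_flag_unique[OF assms] by (intro ex_ex1I) blast+
  then show ?thesis unfolding adj_flag_def agree_off_def by (rule theI')
qed

lemma adj_flag_eqI:
  assumes "A \<in> flags P" "0 \<le> j" "j < int n" "B \<in> flags P" "B \<noteq> A" "agree_off j B A"
  shows "adj_flag P A j = B"
  using adj_flag_props[OF assms(1-3)] adj_flag_unique[OF assms(1-3)] assms(4-6) by blast

lemma adj_flag_invol:
  assumes "A \<in> flags P" "0 \<le> j" "j < int n"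
  shows "adj_flag P (adj_flag P A j) j = A"
  using adj_flag_props[OF assms] assms by (intro adj_flag_eqI) (auto simp: agree_off_iff)

text \<open>The locality behind commutation: the diamond at rank \<open>j\<close> is determined by
  the two neighbouring faces, and the old \<open>j\<close>-face then singles out the new
  one.\<close>

lemma face_at_adj_flag_cong:
  assumes A: "A \<in> flags P" and B: "B \<in> flags P" and j: "0 \<le> j" "j < int n"
    and e: "face_at A (j - 1) = face_at B (j - 1)" "face_at A j = face_at B j"
      "face_at A (j + 1) = face_at B (j + 1)"
  shows "face_at (adj_flag P A j) j = face_at (adj_flag P B j) j"
proof -
  note pA = adj_flag_props[OF A j] and pB = adj_flag_props[OF B j]
  have "face_at (adj_flag P B j) j \<in> between (face_at A (j - 1)) (face_at A (j + 1))"
    unfolding e using pB by (intro agree_off_face_at_self[OF B _ _ j]) auto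
  moreover have "face_at (adj_flag P B j) j \<noteq> face_at A j"
    unfolding e using pB by (intro agree_off_neq[OF B]) auto
  moreover have "face_at (adj_flag P A j) j \<in> between (face_at A (j - 1)) (face_at A (j + 1))"
    using pA by (intro agree_off_face_at_self[OF A _ _ j]) auto
  moreover have "face_at (adj_flag P A j) j \<noteq> face_at A j"
    using pA by (intro agree_off_neq[OF A]) auto
  ultimately show ?thesis
    using card_2_other_unique[OF card_between[OF A j] face_at_between[OF A j]] by blast
qed

lemma face_at_adj_flag:
  assumes "A \<in> flags P" "0 \<le> j" "j < int n" "-1 \<le> k" "k \<le> int n" "k \<noteq> j"
  shows "face_at (adj_flag P A j) k = face_at A k"
  using agree_off_face_at[of A "adj_flag P A j" j k] adj_flag_props[OF assms(1-3)] assms by blast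

text \<open>Since \<open>i + 2 \<le> j\<close>, changing the \<open>j\<close>-face leaves the faces
  of ranks \<open>i - 1\<close>, \<open>i\<close>, \<open>i + 1\<close> alone, and conversely, so
  each exchange is the same before and after the other.\<close>

lemma adj_flag_comm:
  assumes A: "A \<in> flags P" and i: "0 \<le> i" and ij: "i + 2 \<le> j" and j: "j < int n"
  shows "adj_flag P (adj_flag P A j) i = adj_flag P (adj_flag P A i) j"
proof -
  have i': "i < int n" and j': "0 \<le> j" using assms by auto
  have Aj: "adj_flag P A j \<in> flags P" and Ai: "adj_flag P A i \<in> flags P"
    using adj_flag_props[OF A j' j] adj_flag_props[OF A i i'] by auto
  note s = face_at_adj_flag[OF A j' j] face_at_adj_flag[OF A i i']
    face_at_adj_flag[OF Aj i i'] face_at_adj_flag[OF Ai j' j]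
  show ?thesis
  proof (rule flag_eqI)
    show "adj_flag P (adj_flag P A j) i \<in> flags P" "adj_flag P (adj_flag P A i) j \<in> flags P"
      using adj_flag_props[OF Aj i i'] adj_flag_props[OF Ai j' j] by auto
    fix k assume k: "-1 \<le> k" "k \<le> int n"
    consider "k = i" | "k = j" | "k \<noteq> i" "k \<noteq> j" by blast
    then show "face_at (adj_flag P (adj_flag P A j) i) k = face_at (adj_flag P (adj_flag P A i) j) k"
    proof cases
      case 1
      have "face_at (adj_flag P (adj_flag P A j) i) i = face_at (adj_flag P A i) i"
        using assms i' by (intro face_at_adj_flag_cong[OF Aj A i i']) (auto simp: s)
      then show ?thesis using 1 k ij by (simp add: s)
    next
      case 2
      have "face_at (adj_flag P (adj_flag P A i) j) j = face_at (adj_flag P A j) j"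
        using assms i' by (intro face_at_adj_flag_cong[OF Ai A j' j]) (auto simp: s)
      then show ?thesis using 2 k ij by (simp add: s)
    next
      case 3
      then show ?thesis using k by (simp add: s)
    qed
  qed
qed

lemma adjacent_adj_flag:
  assumes A: "A \<in> flags P" and j: "0 \<le> j" "j < int n"
  shows "adjacent P A (adj_flag P A j)"
proof -
  have *: "card (C - D) = 1" if C: "C \<in> flags P" and D: "D \<in> flags P" and CD: "C \<noteq> D" and a: "agree_off j C D" for C D
  proof -
    have jc: "face_at C j \<in> C" "rk P (face_at C j) = j" using face_at_props[OF C, of j] j by auto
    have jd: "face_at D j \<in> D" "rk P (face_at D j) = j" using face_at_props[OF D, of j] j by auto
    have "C - D = {face_at C j}"
    proof
      show "C - D \<subseteq> {face_at C j}"
      proof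
        fix F assume F: "F \<in> C - D"
        then have "rk P F = j" using a by (auto simp: agree_off_iff)
        then show "F \<in> {face_at C j}" using face_at_rk[OF C, of F] F by auto
      qed
      show "{face_at C j} \<subseteq> C - D"
        using jc agree_off_neq[OF D C a CD] face_at_rk[OF D, of "face_at C j"] by auto
    qed
    then show ?thesis by simp
  qed
  show ?thesis unfolding adjacent_def
    using adj_flag_props[OF assms] *[of A "adj_flag P A j"] *[of "adj_flag P A j" A] A
    by (auto simp: agree_off_iff)
qed

text \<open>The flag \<open>B\<close> must replace the lost face \<open>a\<close> by a face of the
  same rank, and its only new face is \<open>b\<close>. That rank is neither \<open>-1\<close> nor
  \<open>n\<close>, because the least and the greatest face are the only faces of these
  ranks.\<close>

lemma adjacent_imp_adj_flag:
  assumes "adjacent P A B"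
  shows "\<exists>j. 0 \<le> j \<and> j < int n \<and> B = adj_flag P A j"
proof -
  have A: "A \<in> flags P" and B: "B \<in> flags P" using assms by (auto simp: adjacent_def)
  obtain a where a: "A - B = {a}" using assms by (auto simp: adjacent_def card_1_singleton_iff)
  obtain b where b: "B - A = {b}" using assms by (auto simp: adjacent_def card_1_singleton_iff)
  have aA: "a \<in> A" "a \<notin> B" and bB: "b \<in> B" "b \<notin> A" using a b by auto
  define j where "j = rk P a"
  have jb: "-1 \<le> j" "j \<le> int n" using rk_bounds flag_faces[OF A] aA unfolding j_def by auto
  have "face_at B j \<in> B" "rk P (face_at B j) = j" using face_at_props[OF B jb] by auto
  moreover have "face_at B j \<notin> A"
    using face_at_rk[OF A, of "face_at B j"] face_at_rk[OF A aA(1)] calculation aA unfolding j_def by auto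
  ultimately have "face_at B j = b" "rk P (face_at B j) = j" using b by (auto simp: set_eq_iff)
  then have rb: "rk P b = j" by simp
  have af: "a \<in> faces P" and bf: "b \<in> faces P" using flag_faces[OF A] flag_faces[OF B] aA bB by auto
  have "j \<noteq> -1"
  proof
    assume j: "j = -1"
    obtain m where m: "m \<in> faces P" "rk P m = -1" "\<forall>G \<in> faces P. (m, G) \<in> le P"
      using abstract_polytope by (auto simp: abstract_polytope_def)
    have "F = m" if "F \<in> faces P" "rk P F = -1" for F
      using m that lt_rk[of m F] by (auto simp: lt_def)
    from this[OF af] this[OF bf] have "a = m" "b = m" using rb j j_def by simp_all
    then show False using aA bB by simp
  qed
  moreover have "j \<noteq> int n"
  proof
    assume j: "j = int n"
    obtain m where m: "m \<in> faces P" "rk P m = int n" "\<forall>G \<in> faces P. (G, m) \<in> le P"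
      using abstract_polytope by (auto simp: abstract_polytope_def)
    have "F = m" if "F \<in> faces P" "rk P F = int n" for F
      using m that lt_rk[of F m] by (auto simp: lt_def)
    from this[OF af] this[OF bf] have "a = m" "b = m" using rb j j_def by simp_all
    then show False using aA bB by simp
  qed
  ultimately have j: "0 \<le> j" "j < int n" using jb by auto
  have "agree_off j B A"
  proof -
    have "F \<in> B \<longleftrightarrow> F \<in> A" if "rk P F \<noteq> j" for F
    proof -
      have "F \<noteq> a" "F \<noteq> b" using that rb j_def by auto
      then have "F \<notin> A - B" "F \<notin> B - A" using a b by simp_all
      then show ?thesis by blast
    qed
    then show ?thesis by (simp add: agree_off_iff)
  qed
  then have "adj_flag P A j = B" using aA B by (intro adj_flag_eqI[OF A j]) auto
  then show ?thesis using j by blast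
qed

text \<open>A chain of greatest cardinality among those through \<open>F\<close> is maximal; one
  exists because chains have bounded size.\<close>

lemma face_in_flag:
  assumes F: "F \<in> faces P"
  shows "\<exists>A \<in> flags P. F \<in> A"
proof -
  let ?S = "{C \<in> Chains (le P). F \<in> C}"
  have "{F} \<in> ?S" using le_refl[OF F] by (auto simp: Chains_def)
  moreover have "\<forall>C. C \<in> ?S \<longrightarrow> card C < n + 3" using chain_finite_card by fastforce
  ultimately have "\<exists>C. C \<in> ?S \<and> (\<forall>D. D \<in> ?S \<longrightarrow> card D \<le> card C)"
    by (rule ex_has_greatest_nat[where P = "\<lambda>C. C \<in> ?S"])
  then obtain C where C: "C \<in> ?S" "\<And>D. D \<in> ?S \<Longrightarrow> card D \<le> card C" by auto
  have "C \<in> flags P" unfolding flags_def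
  proof (intro CollectI conjI ballI impI)
    show "C \<in> Chains (le P)" using C by simp
    fix D assume D: "D \<in> Chains (le P)" "C \<subseteq> D"
    then have "card D \<le> card C" using C by auto
    then have "C = D" using D chain_finite_card[OF D(1)] by (intro card_seteq) auto
    then show "D = C" ..
  qed
  then show ?thesis using C by auto
qed

end

section \<open>Automorphisms of an abstract polytope\<close>

lemma aut_group_group: "group (aut_group P)"
proof (rule groupI)
  let ?E = "faces P"
  let ?G = "aut_group P"
  have car: "f \<in> carrier ?G \<longleftrightarrow> f \<in> Bij ?E \<and>
      (\<forall>F \<in> ?E. \<forall>G \<in> ?E. (f F, f G) \<in> le P \<longleftrightarrow> (F, G) \<in> le P)" for f
    by (simp add: aut_group_def)
  have mult: "f \<otimes>\<^bsub>?G\<^esub> g = compose ?E g f" and one: "\<one>\<^bsub>?G\<^esub> = (\<lambda>F \<in> ?E. F)" for f g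
    by (simp_all add: aut_group_def)
  show "f \<otimes>\<^bsub>?G\<^esub> g \<in> carrier ?G" if "f \<in> carrier ?G" "g \<in> carrier ?G" for f g
  proof -
    have "f F \<in> ?E" if "F \<in> ?E" for F using that \<open>f \<in> carrier ?G\<close> Bij_imp_funcset by (auto simp: car)
    then show ?thesis using that by (simp add: car mult compose_Bij) (simp add: compose_def)
  qed
  show "\<one>\<^bsub>?G\<^esub> \<in> carrier ?G" by (simp add: car one id_Bij)
  show "f \<otimes>\<^bsub>?G\<^esub> g \<otimes>\<^bsub>?G\<^esub> h = f \<otimes>\<^bsub>?G\<^esub> (g \<otimes>\<^bsub>?G\<^esub> h)"
    if "f \<in> carrier ?G" "g \<in> carrier ?G" "h \<in> carrier ?G" for f g h
    using that Bij_imp_funcset[of f ?E] by (simp add: car mult compose_assoc)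
  show "\<one>\<^bsub>?G\<^esub> \<otimes>\<^bsub>?G\<^esub> f = f" if "f \<in> carrier ?G" for f
    using that by (auto simp: car mult one Bij_def compose_def extensional_def fun_eq_iff)
  show "\<exists>g \<in> carrier ?G. g \<otimes>\<^bsub>?G\<^esub> f = \<one>\<^bsub>?G\<^esub>" if f: "f \<in> carrier ?G" for f
  proof
    let ?g = "\<lambda>x \<in> ?E. inv_into ?E f x"
    have bij: "bij_betw f ?E ?E" and fB: "f \<in> Bij ?E" using f by (auto simp: car Bij_def)
    have gE: "inv_into ?E f F \<in> ?E" "f (inv_into ?E f F) = F" if "F \<in> ?E" for F
      using that bij by (auto simp: bij_betw_def inv_into_into f_inv_into_f)
    have "(inv_into ?E f F, inv_into ?E f G) \<in> le P \<longleftrightarrow> (F, G) \<in> le P" if "F \<in> ?E" "G \<in> ?E" for F G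
      using f gE[OF that(1)] gE[OF that(2)] unfolding car by metis
    then show "?g \<in> carrier ?G" using restrict_inv_into_Bij[OF fB] by (simp add: car)
    show "?g \<otimes>\<^bsub>?G\<^esub> f = \<one>\<^bsub>?G\<^esub>"
      unfolding mult one using gE by (auto simp: compose_def fun_eq_iff)
  qed
qed

context polytope
begin

lemma aut_inj: "f \<in> carrier (aut_group P) \<Longrightarrow> inj_on f (faces P)"
  by (auto simp: aut_group_def Bij_def bij_betw_def)

lemma aut_le: "f \<in> carrier (aut_group P) \<Longrightarrow> F \<in> faces P \<Longrightarrow> G \<in> faces P \<Longrightarrow>
    (f F, f G) \<in> le P \<longleftrightarrow> (F, G) \<in> le P"
  by (simp add: aut_group_def)

lemma aut_lt: "f \<in> carrier (aut_group P) \<Longrightarrow> F \<in> faces P \<Longrightarrow> G \<in> faces P \<Longrightarrow>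
    lt P (f F) (f G) \<longleftrightarrow> lt P F G"
  by (simp add: lt_def aut_le inj_on_eq_iff[OF aut_inj])

lemma aut_flag:
  assumes f: "f \<in> carrier (aut_group P)" and A: "A \<in> flags P"
  shows "f ` A \<in> flags P"
proof -
  note AE = flag_faces[OF A]
  have "f ` A \<in> Chains (le P)" unfolding Chains_def
  proof (intro CollectI ballI, elim imageE, hypsubst)
    fix F G assume "F \<in> A" "G \<in> A"
    then show "(f F, f G) \<in> le P \<or> (f G, f F) \<in> le P"
      using aut_le[OF f] AE flag_chain[OF A] by (auto simp: Chains_def subset_iff)
  qed
  moreover have "card (f ` A) = n + 2"
    using card_image[OF inj_on_subset[OF aut_inj[OF f] AE]] flag_card[OF A] by simp
  ultimately show ?thesis by (simp add: flags_iff)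
qed

text \<open>Expresses the rank through the order alone. Automorphisms are only required to preserve
  the order, and this makes them preserve ranks.\<close>

lemma rk_eq_card_below:
  assumes A: "A \<in> flags P" and F: "F \<in> A"
  shows "int (card {H \<in> A. lt P H F}) = rk P F + 1"
proof -
  have F': "-1 \<le> rk P F" "rk P F \<le> int n" using rk_bounds flag_faces[OF A] F by auto
  have "rk P ` {H \<in> A. lt P H F} = {-1..<rk P F}"
  proof
    show "rk P ` {H \<in> A. lt P H F} \<subseteq> {-1..<rk P F}"
      using lt_rk rk_bounds flag_faces[OF A] by fastforce
    show "{-1..<rk P F} \<subseteq> rk P ` {H \<in> A. lt P H F}"
    proof
      fix k assume k: "k \<in> {-1..<rk P F}"
      then have p: "face_at A k \<in> A" "rk P (face_at A k) = k" using face_at_props[OF A, of k] F' by auto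
      then have "lt P (face_at A k) F" using flag_rk_lt[OF A _ F] k by auto
      then show "k \<in> rk P ` {H \<in> A. lt P H F}" using p by (intro image_eqI[of _ _ "face_at A k"]) auto
    qed
  qed
  moreover have "inj_on (rk P) {H \<in> A. lt P H F}"
    by (rule inj_on_subset[OF chain_rk_inj[OF flag_chain[OF A]]]) auto
  ultimately have "card {H \<in> A. lt P H F} = card {-1..<rk P F}" by (metis card_image)
  then show ?thesis using F' by simp
qed

lemma aut_rk:
  assumes f: "f \<in> carrier (aut_group P)" and A: "A \<in> flags P" and F: "F \<in> A"
  shows "rk P (f F) = rk P F"
proof -
  note AE = flag_faces[OF A]
  have "{H \<in> f ` A. lt P H (f F)} = f ` {H \<in> A. lt P H F}"
    using aut_lt[OF f] AE F by (auto simp: subset_iff)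
  moreover have "inj_on f {H \<in> A. lt P H F}"
    by (rule inj_on_subset[OF aut_inj[OF f]]) (use AE in auto)
  ultimately have "card {H \<in> f ` A. lt P H (f F)} = card {H \<in> A. lt P H F}"
    by (simp add: card_image)
  then show ?thesis
    using rk_eq_card_below[OF A F] rk_eq_card_below[OF aut_flag[OF f A], of "f F"] F by simp
qed

lemma aut_adj_flag:
  assumes f: "f \<in> carrier (aut_group P)" and A: "A \<in> flags P" and j: "0 \<le> j" "j < int n"
  shows "f ` adj_flag P A j = adj_flag P (f ` A) j"
proof -
  let ?B = "adj_flag P A j"
  have B: "?B \<in> flags P" "?B \<noteq> A" "agree_off j ?B A" using adj_flag_props[OF A j] by auto
  have "{F \<in> f ` C. rk P F \<noteq> j} = f ` {F \<in> C. rk P F \<noteq> j}" if "C \<in> flags P" for C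
    using aut_rk[OF f that] by auto
  then have "agree_off j (f ` ?B) (f ` A)" using B A by (simp add: agree_off_def)
  moreover have "f ` ?B \<noteq> f ` A"
    using B inj_on_image_eq_iff[OF aut_inj[OF f] flag_faces[OF B(1)] flag_faces[OF A]] by simp
  ultimately show ?thesis using aut_flag[OF f] A B j by (intro adj_flag_eqI[symmetric]) auto
qed

text \<open>An automorphism commutes with the adjacency maps, so fixing one flag it fixes all flags
  reached from it, hence every flag by connectedness. Each face lies in a flag and keeps its rank
  there, so it is fixed too.\<close>

lemma aut_fix_flag:
  assumes f: "f \<in> carrier (aut_group P)" and A: "A \<in> flags P" and fA: "f ` A = A"
  shows "f = \<one>\<^bsub>aut_group P\<^esub>"
proof -
  have all: "f ` B = B" if B: "B \<in> flags P" for B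
  proof -
    have "(A, B) \<in> {(C, D). adjacent P C D \<and> A \<inter> B \<subseteq> C \<and> A \<inter> B \<subseteq> D}\<^sup>*"
      using connected A B by (simp add: strongly_flag_connected_def)
    then show ?thesis
    proof (induction rule: rtrancl_induct)
      case (step C D)
      then have "adjacent P C D" by simp
      then obtain j where "0 \<le> j" "j < int n" "D = adj_flag P C j" "C \<in> flags P"
        using adjacent_imp_adj_flag by (auto simp: adjacent_def)
      then show ?case using aut_adj_flag[OF f] step.IH by simp
    qed (rule fA)
  qed
  have "f F = F" if "F \<in> faces P" for F
  proof -
    obtain B where B: "B \<in> flags P" "F \<in> B" using face_in_flag[OF \<open>F \<in> faces P\<close>] by auto
    have "f F \<in> B" using all[OF B(1)] B(2) by auto
    then show ?thesis using aut_rk[OF f B] face_at_rk[OF B(1)] B(2) by metis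
  qed
  moreover have "f \<in> extensional (faces P)" using f by (simp add: aut_group_def Bij_def)
  ultimately show ?thesis by (auto simp: aut_group_def extensional_def fun_eq_iff)
qed

end

text \<open>The interface between polytopes and flag systems, and the place where chirality enters,
  through \<open>same_orbit\<close>.\<close>

lemma chiral_flag_system:
  assumes "chiral_polytope n P"
  shows "flag_system (aut_group P) (flags P) (\<lambda>f A. f ` A) (\<lambda>j A. adj_flag P A (int j)) n"
proof -
  interpret polytope n P using assms by unfold_locales (simp add: chiral_polytope_def)
  interpret group "aut_group P" by (rule aut_group_group)
  let ?orb = "orbit (aut_group P) (\<lambda>f C. f ` C)"
  have one: "(\<one>\<^bsub>aut_group P\<^esub>) ` A = A" if "A \<in> flags P" for A
    using flag_faces[OF that] by (force simp: aut_group_def)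
  have r: "adj_flag P A (int j) \<in> flags P" if "A \<in> flags P" "j < n" for A j
    using adj_flag_props[OF that(1), of "int j"] that by auto
  show ?thesis
  proof unfold_locales
    show "\<one>\<^bsub>aut_group P\<^esub> ` A = A" if "A \<in> flags P" for A by (rule one[OF that])
    show "(g \<otimes>\<^bsub>aut_group P\<^esub> h) ` A = h ` g ` A" if "A \<in> flags P" for g h A
      using flag_faces[OF that] by (force simp: aut_group_def compose_def image_image)
    show "\<exists>g \<in> carrier (aut_group P). g ` A = adj_flag P (adj_flag P A (int i)) (int j)"
      if A: "A \<in> flags P" and i: "i < n" and j: "j < n" for A i j
    proof -
      let ?B = "adj_flag P A (int i)"
      let ?C = "adj_flag P ?B (int j)"
      have B: "?B \<in> flags P" and C: "?C \<in> flags P" using r A i j by auto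
      have "?orb A \<noteq> ?orb ?B" "?orb ?B \<noteq> ?orb ?C"
        using assms adjacent_adj_flag[OF A, of "int i"] adjacent_adj_flag[OF B, of "int j"] i j
        by (auto simp: chiral_polytope_def)
      moreover have "card (orbits (aut_group P) (flags P) (\<lambda>f C. f ` C)) = 2"
        using assms by (simp add: chiral_polytope_def)
      moreover have "?orb A \<in> orbits (aut_group P) (flags P) (\<lambda>f C. f ` C)"
        "?orb B' \<in> orbits (aut_group P) (flags P) (\<lambda>f C. f ` C)" if "B' \<in> flags P" for B'
        using A that by (auto simp: orbits_def)
      \<comment> \<open>There are only two orbits, and those of \<open>A\<close> and
        \<open>?C\<close> both differ from that of \<open>?B\<close>.\<close>
      ultimately have "?orb A = ?orb ?C"
        using card_2_other_unique[of "orbits (aut_group P) (flags P) (\<lambda>f C. f ` C)"] B C by metis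
      moreover have "?C \<in> ?orb ?C" using one[OF C] by (auto simp: orbit_def intro!: exI[of _ "\<one>\<^bsub>aut_group P\<^esub>"])
      ultimately have "?C \<in> ?orb A" by simp
      then show ?thesis by (auto simp: orbit_def)
    qed
  qed (use r aut_flag aut_fix_flag adj_flag_invol adj_flag_comm aut_adj_flag in auto)
qed

section \<open>Rotations of the mirror image and of the dual\<close>

lemma aut_group_mirror: "aut_group (mirror P) = aut_group P"
  by (simp add: aut_group_def mirror_def faces_def)

lemma adj_flag_mirror: "adj_flag (mirror P) A j = adj_flag P A j"
  by (simp add: adj_flag_def mirror_def flags_def)

lemma aut_group_dual: "aut_group (dual_poset n P) = aut_group P"
proof -
  have "faces (dual_poset n P) = faces P" by (auto simp: faces_def dual_poset_def Field_def)
  then show ?thesis by (auto simp: aut_group_def dual_poset_def)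
qed

lemma adj_flag_dual: "adj_flag (dual_poset n P) A j = adj_flag P A (int n - 1 - j)"
proof -
  have "Chains ((le P)\<inverse>) = Chains (le P)" by (auto simp: Chains_def)
  then have "flags (dual_poset n P) = flags P" by (simp add: flags_def dual_poset_def)
  moreover have "(rk (dual_poset n P) F \<noteq> j) = (rk P F \<noteq> int n - 1 - j)" for F
    by (auto simp: dual_poset_def)
  ultimately show ?thesis by (simp add: adj_flag_def)
qed

lemma rot_gen_flag_rot:
  assumes "1 \<le> i"
  shows "rot_gen P i = flag_rot (aut_group P) (\<lambda>f A. f ` A) (\<lambda>j A. adj_flag P A (int j)) (base P) i"
  using assms by (simp add: rot_gen_def flag_rot_def of_nat_diff)

lemma rot_gen_mirror:
  assumes "1 \<le> i"
  shows "rot_gen (mirror P) i = flag_rot (aut_group P) (\<lambda>f A. f ` A) (\<lambda>j A. adj_flag P A (int j))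
    (adj_flag P (base P) 0) i"
  using assms by (simp add: rot_gen_def flag_rot_def of_nat_diff aut_group_mirror adj_flag_mirror)
    (simp add: mirror_def)

lemma rot_gen_dual:
  assumes "i \<in> {1..n - 1}"
  shows "rot_gen (dual_poset n P) i = flag_rot (aut_group P) (\<lambda>f A. f ` A)
    (\<lambda>j A. adj_flag P A (int (n - 1 - j))) (base P) i"
proof -
  have i: "int (n - 1 - i) = int n - 1 - int i" "int (n - 1 - (i - 1)) = int n - 1 - (int i - 1)"
    using assms by auto
  have b: "base (dual_poset n P) = base P" by (simp add: dual_poset_def)
  show ?thesis
    unfolding rot_gen_def flag_rot_def aut_group_dual adj_flag_dual i b ..
qed

lemma mix_cong:
  "(\<And>i. i \<in> I \<Longrightarrow> x i = x' i) \<Longrightarrow> (\<And>i. i \<in> I \<Longrightarrow> y i = y' i) \<Longrightarrow> mix I G x H y = mix I G x' H y'"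
  by (simp add: mix_def cong: image_cong)

section \<open>Chirality of the mix of a chiral polytope with its dual\<close>

theorem corollary5p5:
  fixes P :: "'a based_poset" and n :: nat and p :: "nat \<Rightarrow> nat"
  assumes "chiral_polytope n P"
    and "has_type n P p"
    and "(ecard (carrier (polytope_mix_group n P (mirror P))) / ecard (carrier (aut_group P)))\<^sup>2
         > ecard (carrier (comix {1..n - 1} (coxeter_rot_relators n p)
                                            (coxeter_rot_relators n (\<lambda>i. p (n - i)))))"
  shows "mix_chiral n P (dual_poset n P)"
proof -
  let ?G = "aut_group P" and ?I = "{1..n - 1}"
  let ?act = "\<lambda>f A. f ` A" and ?r = "\<lambda>j A. adj_flag P A (int j)"
  let ?W = "lists (?I \<times> (UNIV :: bool set))"
  let ?C = "carrier (comix ?I (coxeter_rot_relators n p) (coxeter_rot_relators n (\<lambda>i. p (n - i))))"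
  interpret polytope n P using assms(1) by unfold_locales (simp add: chiral_polytope_def)
  interpret flag_system ?G "flags P" ?act ?r n by (rule chiral_flag_system[OF assms(1)])
  define x y where "x = rot (base P)" and "y = flag_rot ?G ?act (\<lambda>j. ?r (n - 1 - j)) (base P)"
  have x: "rot_gen P i = x i" if "i \<in> ?I" for i using that rot_gen_flag_rot x_def by auto
  have y: "rot_gen (dual_poset n P) i = y i" if "i \<in> ?I" for i using rot_gen_dual[OF that] y_def by simp
  let ?K = "mix ?I ?G x ?G (rot (?r 0 (base P)))"
  have K: "polytope_mix_group n P (mirror P) = ?K"
    unfolding polytope_mix_group_def aut_group_mirror
    by (rule mix_cong) (auto simp: x rot_gen_mirror)
  have M: "polytope_mix_group n P (dual_poset n P) = mix ?I ?G x ?G y"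
    unfolding polytope_mix_group_def aut_group_dual by (rule mix_cong) (simp_all only: x y)
  have hyp: "ecard ?C < (ecard (carrier ?K) / ecard (carrier ?G))\<^sup>2" using assms(3) K by simp
  \<comment> \<open>An infinite denominator makes the quotient zero in \<open>ennreal\<close>, and
    nothing lies strictly below zero.\<close>
  have fin: "finite (carrier ?G)"
  proof (rule ccontr)
    assume "infinite (carrier ?G)"
    then show False using hyp by (simp add: ecard_def)
  qed
  have finC: "finite ?C"
  proof (rule ccontr)
    assume "infinite ?C"
    then show False using hyp by (simp add: ecard_def)
  qed
  have xPi: "x \<in> ?I \<rightarrow> carrier ?G" using rot_Pi[OF base_flag] by (simp add: x_def)
  interpret d: flag_system ?G "flags P" ?act "\<lambda>j. ?r (n - 1 - j)" n by (rule dual_flag_system)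
  have yPi: "y \<in> ?I \<rightarrow> carrier ?G" using d.rot_Pi[OF base_flag] by (simp add: y_def)
  note Mmix = word_eval_mix[OF is_group is_group xPi yPi]
  have gpos: "0 < card (carrier ?G)" using fin by (auto simp: card_gt_0_iff)
  have sub: "carrier (mix ?I ?G u ?G v) \<subseteq> carrier ?G \<times> carrier ?G" for u v
  proof -
    interpret GG: group "?G \<times>\<times> ?G" by (rule DirProd_group) unfold_locales
    show ?thesis unfolding mix_def using GG.carrier_subgroup_generated_subset by simp
  qed
  have finK: "finite (carrier ?K)" by (rule finite_subset[OF sub]) (use fin in simp)
  have less: "card ?C * (card (carrier ?G))\<^sup>2 < (card (carrier ?K))\<^sup>2"
  proof -
    have "ennreal (real (card ?C)) < (ennreal (real (card (carrier ?K))) / ennreal (real (card (carrier ?G))))\<^sup>2"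
      using hyp fin finC finK by (simp add: ecard_def ennreal_of_nat_eq_real_of_nat)
    also have "\<dots> = ennreal ((real (card (carrier ?K)) / real (card (carrier ?G)))\<^sup>2)"
      using gpos by (simp add: divide_ennreal ennreal_power)
    finally have "real (card ?C) < (real (card (carrier ?K)) / real (card (carrier ?G)))\<^sup>2"
      by (simp add: ennreal_less_iff)
    then have "real (card ?C) * (real (card (carrier ?G)))\<^sup>2 < (real (card (carrier ?K)))\<^sup>2"
      using gpos by (simp add: power_divide field_simps)
    then show ?thesis by (simp flip: of_nat_power of_nat_mult)
  qed
  \<comment> \<open>Below rank two there are no generators, so \<open>?K\<close> is trivial, while
    the group and the comix each have at least one element; the strict inequality would read that at
    least one is less than one.\<close>
  have n: "2 \<le> n"
  proof (rule ccontr)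
    assume "\<not> 2 \<le> n"
    then have I: "?I = {}" by auto
    interpret GG: group "?G \<times>\<times> ?G" by (rule DirProd_group) unfold_locales
    have "carrier ?K = {\<one>\<^bsub>?G \<times>\<times> ?G\<^esub>}"
      unfolding mix_def I carrier_subgroup_generated by (simp add: GG.generate_empty)
    then have "card (carrier ?K) = 1" by simp
    moreover have "?C \<noteq> {}" by (auto simp: comix_def presented_group_def quotient_def)
    then have "1 \<le> card ?C" using finC by (simp add: Suc_le_eq card_gt_0_iff)
    moreover have "1 \<le> (card (carrier ?G))\<^sup>2" using gpos by simp
    ultimately show False using less by simp
  qed
  let ?M = "mix ?I ?G x ?G y" and ?z = "\<lambda>i. (x i, y i)"
  interpret M: group ?M by (rule Mmix(1))
  interpret D: von_dyck ?M ?I "string_relators n" ?z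
  proof
    show "?z \<in> ?I \<rightarrow> carrier ?M" by (rule Mmix(2))
    fix w :: "nat word" assume w: "w \<in> string_relators n" "w \<in> ?W"
    show "word_eval ?M ?z w = \<one>\<^bsub>?M\<^esub>"
      unfolding Mmix(3)[OF w(2)] Mmix(5)
      using word_eval_string_relator[OF base_flag w(1)] d.word_eval_string_relator[OF base_flag w(1)]
      by (simp add: x_def y_def)
  qed
  \<comment> \<open>The epimorphism demanded by \<open>Wplus_quotient\<close>; its kernel is the
    witness for \<open>N\<close> in \<open>mix_chiral\<close>.\<close>
  let ?h = "pres_hom ?M ?z"
  define N where "N = kernel (Wplus n) ?M ?h"
  have Wn: "Wplus n = presented_group ?I (string_relators n)" by (simp add: Wplus_def)
  have epi: "?h \<in> epi (Wplus n) ?M"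
    unfolding epi_def Wn using D.pres_hom_hom D.pres_hom_image Mmix(4) Mmix(3)
    by (simp cong: image_cong)
  have gens: "?h (Wplus_gen n i) = (rot_gen P i, rot_gen (dual_poset n P) i)" if "i \<in> ?I" for i
  proof -
    have "?z i \<in> carrier ?M" using Mmix(2) that by (rule funcset_mem)
    then have "word_eval ?M ?z [(i, True)] = ?z i" by (simp only: word_eval.simps if_True M.r_one)
    moreover have "[(i, True)] \<in> ?W" using that by simp
    ultimately show ?thesis
      unfolding Wplus_gen_def x[OF that] y[OF that] by (simp only: D.pres_hom_class)
  qed
  have quot: "Wplus_quotient n (polytope_mix_group n P (dual_poset n P))
      (\<lambda>i. (rot_gen P i, rot_gen (dual_poset n P) i)) N"
    unfolding Wplus_quotient_def M N_def using epi gens by blast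
  have "Wplus_bar n ` N \<noteq> N"
  proof
    assume inv: "Wplus_bar n ` N = N"
    have bar: "word_eval ?G x (bar_word w) = \<one>\<^bsub>?G\<^esub> \<and> word_eval ?G y (bar_word w) = \<one>\<^bsub>?G\<^esub>"
      if w: "w \<in> ?W" and wx: "word_eval ?G x w = \<one>\<^bsub>?G\<^esub>" and wy: "word_eval ?G y w = \<one>\<^bsub>?G\<^esub>" for w
    proof -
      \<comment> \<open>Passage from words to classes: the class of \<open>w\<close> lies in
        \<open>N\<close>, hence so does its image under \<open>Wplus_bar\<close>. That image
        contains \<open>bar_word w\<close>, and any of its members may be used to evaluate
        \<open>?h\<close>.\<close>
      let ?A = "pres_rel ?I (string_relators n) `` {w}"
      have bw: "bar_word w \<in> ?W" by (rule bar_word_lists[OF n w])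
      have "?A \<in> N" unfolding N_def kernel_def Wn
        using D.class_in_carrier[OF w] D.pres_hom_class[OF w] Mmix(3)[OF w] Mmix(5) wx wy
        by (simp only: mem_Collect_eq)
      then have "Wplus_bar n ?A \<in> N" using inv by blast
      then have B: "Wplus_bar n ?A \<in> carrier (presented_group ?I (string_relators n))"
        "?h (Wplus_bar n ?A) = \<one>\<^bsub>?M\<^esub>" unfolding N_def kernel_def Wn by simp_all
      have "bar_word w \<in> Wplus_bar n ?A"
        unfolding Wplus_bar_def using pres_class_self[OF w, of "string_relators n"]
          pres_class_self[OF bw, of "string_relators n"] by blast
      then have "word_eval ?M ?z (bar_word w) = \<one>\<^bsub>?M\<^esub>" using D.pres_hom_eq[OF B(1)] B(2) by simp
      then show ?thesis unfolding Mmix(3)[OF bw] Mmix(5) by simp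
    qed
    have p: "rot (base P) i [^]\<^bsub>?G\<^esub> p i = \<one>\<^bsub>?G\<^esub>" if "i \<in> ?I" for i
    proof -
      \<comment> \<open>For a rotation of infinite order \<open>ord\<close> is \<open>0\<close>, and
        the power relation still holds.\<close>
      have "p i = ord (x i)" using assms(2) x[OF that] that by (simp add: has_type_def)
      moreover have "x i \<in> carrier ?G" using xPi that by (rule funcset_mem)
      ultimately show ?thesis using pow_ord_eq_1 by (simp add: x_def)
    qed
    have "(card (carrier ?K))\<^sup>2 \<le> (card (carrier ?G))\<^sup>2 * card ?C"
      unfolding x_def
      by (rule card_mix_mirror_bound[OF n fin base_flag p finC bar[unfolded x_def y_def]])
    then show False using less by (simp add: mult.commute)
  qed
  then show ?thesis unfolding mix_chiral_def using quot by blast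
qed

end
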